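(* Let $(X,d)$ be a complete Alexandrov space with curvature bounded above by $\kappa$. Let $f:X\to(-\infty,\infty]$ be a convex, lower semi-continuous function (not identically $+\infty$), and let $G\subset X$ be a closed, geodesically convex set containing a nonempty sublevel set of $f$, with $\operatorname{diam}G<\pi/(2\sqrt\kappa)$ if $\kappa>0$. Let $\{\lambda_k\}_{k\ge1}$ be positive with $\sum_{k=1}^\infty\lambda_k=+\infty$. Fix $x_0\in G$ and set $x_k:=J^f_{\lambda_k}(x_{k-1})$ for $k\ge1$, where $J^f_\lambda(x):=\operatorname{argmin}_{y\in G}\{f(y)+\frac1{2\lambda}d(x,y)^2\}$. Then $\lim_{k\to\infty}f(x_k)=\inf_{y\in G}f(y)$.
   Context: Minimal geodesics $x\#_ty$ satisfy $d(x\#_sy,x\#_ty)=|s-t|d(x,y)$; a set is geodesically convex if it contains all minimal geodesics between its points. A geodesic metric space is an Alexandrov space of curvature bounded above by $\kappa$ if for all $x,y,z$ (perimeter $<2\pi/\sqrt\kappa$ if $\kappa>0$), all $t\in[0,1]$ and all minimal geodesics, $d(y\#_tz,x)\le d_{\mathbb{M}^2(\kappa)}(\tilde y\#_t\tilde z,\tilde x)$, where $\tilde x\tilde y\tilde z$ is a comparison triangle with the same side lengths in the simply connected surface $\mathbb{M}^2(\kappa)$ of constant curvature $\kappa$. $f$ is convex if $f(x\#_ty)\le(1-t)f(x)+tf(y)$ along all minimal geodesics. The minimizer defining $J^f_\lambda(x)$ exists and is unique under these assumptions. *)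

theory Defs
  imports "HOL-Analysis.Analysis"
begin

definition min_geodesic :: "'b set \<Rightarrow> ('b \<Rightarrow> 'b \<Rightarrow> real) \<Rightarrow> 'b \<Rightarrow> 'b \<Rightarrow> (real \<Rightarrow> 'b) \<Rightarrow> bool" where
  "min_geodesic S d x y g \<longleftrightarrow>
     g 0 = x \<and> g 1 = y \<and> g ` {0..1} \<subseteq> S \<and>
     (\<forall>s\<in>{0..1}. \<forall>t\<in>{0..1}. d (g s) (g t) = \<bar>s - t\<bar> * d x y)"

definition geodesic_space :: "'a::metric_space itself \<Rightarrow> bool" where
  "geodesic_space _ \<longleftrightarrow> (\<forall>x y::'a. \<exists>g. min_geodesic UNIV dist x y g)"

definition geodesically_convex :: "'a::metric_space set \<Rightarrow> bool" where
  "geodesically_convex G \<longleftrightarrow>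
     (\<forall>x\<in>G. \<forall>y\<in>G. \<forall>g. min_geodesic UNIV dist x y g \<longrightarrow> g ` {0..1} \<subseteq> G)"

text \<open>Model surface M^2(kappa) of constant curvature kappa, realised in R^3:
  sphere of radius 1/sqrt kappa (kappa > 0), the plane z = 0 (kappa = 0),
  upper sheet of the hyperboloid x^2+y^2-z^2 = 1/kappa (kappa < 0).\<close>
definition model_space :: "real \<Rightarrow> (real \<times> real \<times> real) set" where
  "model_space \<kappa> =
     (if \<kappa> > 0 then {(a,b,c). a\<^sup>2 + b\<^sup>2 + c\<^sup>2 = 1 / \<kappa>}
      else if \<kappa> = 0 then {(a,b,c). c = 0}
      else {(a,b,c). a\<^sup>2 + b\<^sup>2 - c\<^sup>2 = 1 / \<kappa> \<and> c > 0})"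

definition model_dist :: "real \<Rightarrow> real \<times> real \<times> real \<Rightarrow> real \<times> real \<times> real \<Rightarrow> real" where
  "model_dist \<kappa> p q =
     (case p of (a,b,c) \<Rightarrow> case q of (a',b',c') \<Rightarrow>
       (if \<kappa> > 0 then arccos (\<kappa> * (a*a' + b*b' + c*c')) / sqrt \<kappa>
        else if \<kappa> = 0 then sqrt ((a - a')\<^sup>2 + (b - b')\<^sup>2 + (c - c')\<^sup>2)
        else arcosh (\<kappa> * (a*a' + b*b' - c*c')) / sqrt (- \<kappa>)))"

definition alexandrov_le :: "real \<Rightarrow> 'a::metric_space itself \<Rightarrow> bool" where
  "alexandrov_le \<kappa> T \<longleftrightarrow> geodesic_space T \<and>
     (\<forall>x y z::'a. \<forall>g t.
        (\<kappa> > 0 \<longrightarrow> dist x y + dist y z + dist z x < 2 * pi / sqrt \<kappa>) \<longrightarrow>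
        min_geodesic UNIV dist y z g \<longrightarrow> t \<in> {0..1} \<longrightarrow>
        (\<forall>x' y' z' g'.
           x' \<in> model_space \<kappa> \<and> y' \<in> model_space \<kappa> \<and> z' \<in> model_space \<kappa> \<and>
           model_dist \<kappa> x' y' = dist x y \<and> model_dist \<kappa> y' z' = dist y z \<and>
           model_dist \<kappa> z' x' = dist z x \<and>
           min_geodesic (model_space \<kappa>) (model_dist \<kappa>) y' z' g' \<longrightarrow>
           dist (g t) x \<le> model_dist \<kappa> (g' t) x'))"

definition convex_fun :: "('a::metric_space \<Rightarrow> ereal) \<Rightarrow> bool" where
  "convex_fun f \<longleftrightarrow>
     (\<forall>x y g t. min_geodesic UNIV dist x y g \<longrightarrow> t \<in> {0..1} \<longrightarrow>
        f (g t) \<le> ereal (1 - t) * f x + ereal t * f y)"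

definition lsc :: "('a::topological_space \<Rightarrow> ereal) \<Rightarrow> bool" where
  "lsc f \<longleftrightarrow> (\<forall>c. closed {x. f x \<le> c})"

definition resolvent :: "('a::metric_space \<Rightarrow> ereal) \<Rightarrow> 'a set \<Rightarrow> real \<Rightarrow> 'a \<Rightarrow> 'a" where
  "resolvent f G lam x =
     (THE y. y \<in> G \<and>
        (\<forall>z\<in>G. f y + ereal ((dist x y)\<^sup>2 / (2 * lam)) \<le> f z + ereal ((dist x z)\<^sup>2 / (2 * lam))))"

end

theory Submission
  imports Defs
begin

text \<open>
  The heart of the matter is the estimate
  \<open>2 \<lambda> (f p - f y) \<le> d(x, y)\<^sup>2 - d(p, y)\<^sup>2\<close> for \<open>p = J\<^sub>\<lambda> x\<close> and \<open>f y \<le> f p\<close>. Moving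
  from \<open>p\<close> towards \<open>y\<close> cannot decrease \<open>f + d(x, \<cdot>)\<^sup>2 / (2\<lambda>)\<close>; by convexity of \<open>f\<close> and the
  curvature bound the derivative at \<open>p\<close> of the squared distance to \<open>x\<close> in the comparison triangle,
  \<open>- 2 d(x, p) d(p, y) cos \<theta>\<close>, is at least \<open>2 \<lambda> (f p - f y) \<ge> 0\<close>. So the comparison angle
  \<open>\<theta>\<close> at \<open>p\<close> is obtuse, and then \<open>d(x, y)\<^sup>2 \<ge> d(p, y)\<^sup>2 - 2 d(x, p) d(p, y) cos \<theta>\<close> in the model
  surface as long as the sides are shorter than \<open>\<pi> / (2 sqrt \<kappa>)\<close>. Telescoping over the iteration
  contradicts the divergence of the sum of the \<open>\<lambda>\<close>s if the values \<open>f(x\<^sub>k)\<close> stay away from the infimum.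

  Existence and uniqueness of \<open>J\<^sub>\<lambda> x\<close> come from the uniform convexity of the squared distance on
  \<open>G\<close>: bounded decreasing sequences of nonempty closed convex subsets have a common point. All
  model computations reduce to the convexity of \<open>s \<mapsto> cosh (sqrt s)\<close> and \<open>s \<mapsto> cos (sqrt s)\<close>.
\<close>

section \<open>Inequalities for hyperbolic and spherical triangles\<close>

text \<open>Extracts first-order information: once an inequality along a geodesic is divided by
  \<open>t\<close>, the remainder \<open>t * b\<close> vanishes as \<open>t\<close> tends to 0 from
  the right.\<close>

lemma le_zero_if_le_mult_small:
  fixes D b :: real
  assumes "\<And>t. 0 < t \<Longrightarrow> t \<le> 1 \<Longrightarrow> D \<le> t * b"
  shows "D \<le> 0"
proof (rule tendsto_lowerbound)
  show "((\<lambda>t. t * b) \<longlongrightarrow> 0) (at_right 0)"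
    by (auto intro!: tendsto_eq_intros)
  show "\<forall>\<^sub>F t in at_right 0. D \<le> t * b"
    using assms by (auto simp: eventually_at_right_field intro!: exI[of _ 1])
qed simp

text \<open>A convex function vanishing at 0 has increasing quotients \<open>sinh u / u\<close>.
  This is the \<open>mono\<close> hypothesis of \<open>square_tangent\<close> for
  \<open>\<psi> = cosh\<close>.\<close>

lemma sinh_mult_le:
  fixes u v :: real
  assumes "0 \<le> u" "u \<le> v"
  shows "sinh u * v \<le> sinh v * u"
proof (cases "v = 0")
  case False
  have "convex_on {0..} (sinh :: real \<Rightarrow> real)"
    by (rule f''_ge0_imp_convex[where f' = cosh and f'' = sinh])
      (auto intro!: derivative_eq_intros)
  then have "sinh ((1 - u / v) *\<^sub>R 0 + (u / v) *\<^sub>R v) \<le> (1 - u / v) * sinh 0 + (u / v) * sinh v"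
    using assms False by (intro convex_onD) auto
  then show ?thesis
    using assms False by (simp add: field_simps)
qed (use assms in auto)

text \<open>Concavity reverses the inequality, which is what \<open>square_tangent\<close> asks of
  \<open>\<psi> = cos\<close>, whose derivative is \<open>- sin\<close>.\<close>

lemma sin_mult_le:
  fixes u v :: real
  assumes "0 \<le> u" "u \<le> v" "v \<le> pi"
  shows "sin v * u \<le> sin u * v"
proof (cases "v = 0")
  case False
  have "concave_on {0..pi} (sin :: real \<Rightarrow> real)"
    by (rule f''_le0_imp_concave[where f' = cos and f'' = "\<lambda>x. - sin x"])
      (auto intro!: derivative_eq_intros sin_ge_zero)
  then have "(1 - u / v) * sin 0 + (u / v) * sin v \<le> sin ((1 - u / v) *\<^sub>R 0 + (u / v) *\<^sub>R v)"
    using assms False by (intro concave_onD) auto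
  then show ?thesis
    using assms False by (simp add: field_simps)
qed (use assms in auto)

lemma mult_cos_le_sin:
  fixes a :: real
  assumes "0 \<le> a" "a \<le> pi"
  shows "a * cos a \<le> sin a"
proof -
  have "sin 0 - 0 * cos 0 \<le> sin a - a * cos a"
  proof (rule DERIV_nonneg_imp_nondecreasing[OF assms(1)])
    fix x :: real assume "0 \<le> x" "x \<le> a"
    then show "\<exists>y. ((\<lambda>x. sin x - x * cos x) has_real_derivative y) (at x) \<and> 0 \<le> y"
      using assms by (intro exI[of _ "x * sin x"])
        (auto intro!: derivative_eq_intros mult_nonneg_nonneg sin_ge_zero)
  qed
  then show ?thesis by simp
qed

text \<open>The monotonicity hypothesis says that \<open>D u / u\<close> is increasing, that is, that
  \<open>s \<mapsto> \<psi> (sqrt s)\<close> is convex.\<close>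

lemma square_tangent:
  fixes \<psi> D :: "real \<Rightarrow> real"
  assumes deriv: "\<And>u. (\<psi> has_real_derivative D u) (at u)"
    and mono: "\<And>u v. 0 \<le> u \<Longrightarrow> u \<le> v \<Longrightarrow> v \<le> B \<Longrightarrow> D u * v \<le> D v * u"
    and q: "0 < q" "q \<le> B" and u: "0 \<le> u" "u \<le> B"
  shows "\<psi> q + D q / (2 * q) * (u\<^sup>2 - q\<^sup>2) \<le> \<psi> u"
proof -
  \<comment> \<open>\<open>D q / (2 * q)\<close> is the slope of
    \<open>s \<mapsto> \<psi> (sqrt s)\<close> at the square of \<open>q\<close>. With the tangent
    subtracted, \<open>mono\<close> makes the derivative nonpositive before \<open>q\<close> and
    nonnegative after it, so \<open>q\<close> is a minimum.\<close>
  define \<phi> where "\<phi> = (\<lambda>u. \<psi> u - D q / (2 * q) * u\<^sup>2)"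
  have \<phi>': "(\<phi> has_real_derivative D x - D q / q * x) (at x)" for x
    unfolding \<phi>_def using q by (auto intro!: derivative_eq_intros deriv)
  have "\<phi> q \<le> \<phi> u"
  proof (cases "u \<le> q")
    case True
    show ?thesis
    proof (rule DERIV_nonpos_imp_nonincreasing[OF True])
      fix x assume "u \<le> x" "x \<le> q"
      then have "D x - D q / q * x \<le> 0"
        using mono[of x q] q u by (simp add: field_simps)
      then show "\<exists>y. (\<phi> has_real_derivative y) (at x) \<and> y \<le> 0"
        using \<phi>' by blast
    qed
  next
    case False
    then have qu: "q \<le> u" by simp
    show ?thesis
    proof (rule DERIV_nonneg_imp_nondecreasing[OF qu])
      fix x
      assume "q \<le> x" "x \<le> u"
      then have "0 \<le> D x - D q / q * x"
        using mono[of q x] q u by (simp add: field_simps)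
      then show "\<exists>y. (\<phi> has_real_derivative y) (at x) \<and> 0 \<le> y"
        using \<phi>' by blast
    qed
  qed
  then show ?thesis by (simp add: \<phi>_def algebra_simps)
qed

text \<open>The chord inequality for \<open>s \<mapsto> \<psi> (sqrt s)\<close> between the squares
  of \<open>e - h\<close> and \<open>e + h\<close>, an interval of length \<open>4 * e * h\<close>.
  It is the weighted sum of two instances of the tangent inequality at \<open>b\<close>.\<close>

lemma square_chord:
  fixes \<psi> D :: "real \<Rightarrow> real"
  assumes deriv: "\<And>u. (\<psi> has_real_derivative D u) (at u)"
    and mono: "\<And>u v. 0 \<le> u \<Longrightarrow> u \<le> v \<Longrightarrow> v \<le> B \<Longrightarrow> D u * v \<le> D v * u"
    and eh: "0 \<le> e" "0 \<le> h" "e + h \<le> B" and b: "\<bar>e - h\<bar> \<le> b" "b \<le> e + h"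
  shows "4 * e * h * \<psi> b
    \<le> ((e + h)\<^sup>2 - b\<^sup>2) * \<psi> \<bar>e - h\<bar> + (b\<^sup>2 - (e - h)\<^sup>2) * \<psi> (e + h)"
\<comment> \<open>The tangent needs a positive base point; for \<open>b = 0\<close> both sides
  agree.\<close>
proof (cases "b = 0")
  case True
  with b have "e = h" by simp
  with True show ?thesis by (simp add: power2_eq_square)
next
  case False
  with b have b0: "0 < b" by linarith
  define m where "m = D b / (2 * b)"
  have 1: "\<psi> b + m * ((e - h)\<^sup>2 - b\<^sup>2) \<le> \<psi> \<bar>e - h\<bar>"
    using square_tangent[OF deriv mono b0, of B "\<bar>e - h\<bar>"] b eh by (simp add: m_def)
  have 2: "\<psi> b + m * ((e + h)\<^sup>2 - b\<^sup>2) \<le> \<psi> (e + h)"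
    using square_tangent[OF deriv mono b0, of B "e + h"] b eh by (simp add: m_def)
  have "0 \<le> (e + h)\<^sup>2 - b\<^sup>2"
    using power_mono[OF b(2), of 2] b0 by simp
  from mult_left_mono[OF 1 this]
  have 3: "((e + h)\<^sup>2 - b\<^sup>2) * (\<psi> b + m * ((e - h)\<^sup>2 - b\<^sup>2)) \<le> ((e + h)\<^sup>2 - b\<^sup>2) * \<psi> \<bar>e - h\<bar>" .
  have "0 \<le> b\<^sup>2 - (e - h)\<^sup>2"
    using power_mono[OF b(1), of 2] by simp
  from mult_left_mono[OF 2 this]
  have 4: "(b\<^sup>2 - (e - h)\<^sup>2) * (\<psi> b + m * ((e + h)\<^sup>2 - b\<^sup>2)) \<le> (b\<^sup>2 - (e - h)\<^sup>2) * \<psi> (e + h)" .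
  have "4 * e * h * \<psi> b = ((e + h)\<^sup>2 - b\<^sup>2) * (\<psi> b + m * ((e - h)\<^sup>2 - b\<^sup>2))
     + (b\<^sup>2 - (e - h)\<^sup>2) * (\<psi> b + m * ((e + h)\<^sup>2 - b\<^sup>2))"
    by (simp add: power2_eq_square algebra_simps)
  with 3 4 show ?thesis by linarith
qed

text \<open>For positive sides, dividing by the factors in front shows that the Euclidean cosine of
  the angle between \<open>e\<close> and \<open>h\<close> is at most the hyperbolic one. Since
  \<open>cosh (e - h)\<close> and \<open>cosh (e + h)\<close> are the degenerate third sides, the
  chord inequality is exactly this comparison.\<close>

lemma cosh_law_le_euclidean:
  fixes e h b :: real
  assumes "0 \<le> e" "0 \<le> h" "\<bar>e - h\<bar> \<le> b" "b \<le> e + h"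
  shows "sinh e * sinh h * (e\<^sup>2 + h\<^sup>2 - b\<^sup>2) \<le> 2 * e * h * (cosh e * cosh h - cosh b)"
proof -
  have "4 * e * h * cosh b
    \<le> ((e + h)\<^sup>2 - b\<^sup>2) * cosh \<bar>e - h\<bar> + (b\<^sup>2 - (e - h)\<^sup>2) * cosh (e + h)"
    by (rule square_chord[where D = sinh and B = "e + h"])
      (use assms sinh_mult_le in \<open>auto intro!: derivative_eq_intros\<close>)
  also have "cosh \<bar>e - h\<bar> = cosh (e - h)"
    by (simp add: abs_if cosh_minus[of "e - h", symmetric] del: cosh_minus)
  finally show ?thesis
    by (simp add: cosh_add cosh_diff power2_eq_square algebra_simps)
qed

text \<open>The same argument for \<open>cos\<close>, with the angle comparison reversed. The bound
  \<open>e + h \<le> pi\<close> keeps the chord in the range where \<open>sin_mult_le\<close>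
  applies.\<close>

lemma cos_law_ge_euclidean:
  fixes e h b :: real
  assumes "0 \<le> e" "0 \<le> h" "e + h \<le> pi" "\<bar>e - h\<bar> \<le> b" "b \<le> e + h"
  shows "2 * e * h * (cos b - cos e * cos h) \<le> sin e * sin h * (e\<^sup>2 + h\<^sup>2 - b\<^sup>2)"
proof -
  have "4 * e * h * cos b
    \<le> ((e + h)\<^sup>2 - b\<^sup>2) * cos \<bar>e - h\<bar> + (b\<^sup>2 - (e - h)\<^sup>2) * cos (e + h)"
    by (rule square_chord[where D = "\<lambda>x. - sin x" and B = "e + h"])
      (use assms sin_mult_le in \<open>auto intro!: derivative_eq_intros\<close>)
  also have "cos \<bar>e - h\<bar> = cos (e - h)" by simp
  finally show ?thesis
    by (simp add: cos_add cos_diff power2_eq_square algebra_simps)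
qed

text \<open>Adding \<open>cosh_law_le_euclidean\<close> at the two supplementary angles at the dividing point
  of the side \<open>h + k\<close> turns the hyperbolic Stewart identity into the Euclidean inequality.\<close>

lemma hyperbolic_stewart_le_euclidean:
  fixes d h k b c :: real
  assumes "0 < d" "0 < h" "0 < k"
    and b: "\<bar>d - h\<bar> \<le> b" "b \<le> d + h" and c: "\<bar>d - k\<bar> \<le> c" "c \<le> d + k"
    and le: "cosh d * sinh (h + k) \<le> sinh k * cosh b + sinh h * cosh c"
  shows "k * (d\<^sup>2 + h\<^sup>2 - b\<^sup>2) + h * (d\<^sup>2 + k\<^sup>2 - c\<^sup>2) \<le> 0"
proof -
  \<comment> \<open>The multipliers give the two angle inequalities the common factors
    \<open>sinh d * sinh h * sinh k\<close> and \<open>2 * d * h * k\<close>, so their sum contains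
    \<open>sinh (h + k)\<close>.\<close>
  have "k * sinh k * (sinh d * sinh h * (d\<^sup>2 + h\<^sup>2 - b\<^sup>2))
      \<le> k * sinh k * (2 * d * h * (cosh d * cosh h - cosh b))"
    using cosh_law_le_euclidean[OF _ _ b] assms by (intro mult_left_mono) auto
  moreover have "h * sinh h * (sinh d * sinh k * (d\<^sup>2 + k\<^sup>2 - c\<^sup>2))
      \<le> h * sinh h * (2 * d * k * (cosh d * cosh k - cosh c))"
    using cosh_law_le_euclidean[OF _ _ c] assms by (intro mult_left_mono) auto
  ultimately have "sinh d * sinh h * sinh k * (k * (d\<^sup>2 + h\<^sup>2 - b\<^sup>2) + h * (d\<^sup>2 + k\<^sup>2 - c\<^sup>2))
     \<le> 2 * d * h * k * (cosh d * sinh (h + k) - (sinh k * cosh b + sinh h * cosh c))"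
    by (simp add: sinh_add algebra_simps)
  also have "\<dots> \<le> 0"
    using assms by (intro mult_nonneg_nonpos) auto
  finally show ?thesis
    using assms by (simp add: mult_le_0_iff)
qed

section \<open>Quantitative estimates for spherical triangles\<close>

lemma cos_ge_one_minus:
  fixes u :: real
  shows "1 - u\<^sup>2 / 2 \<le> cos u"
proof -
  have "\<bar>sin (u / 2)\<bar>\<^sup>2 \<le> \<bar>u / 2\<bar>\<^sup>2"
    by (intro power_mono abs_sin_x_le_abs_x) auto
  then have "2 * (sin (u / 2))\<^sup>2 \<le> u\<^sup>2 / 2"
    by (simp add: power2_eq_square)
  then show ?thesis
    using cos_double_sin[of "u / 2"] by simp
qed

lemma cos_tangent:
  fixes q u :: real
  assumes "0 < q" "q \<le> pi" "0 \<le> u" "u \<le> pi"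
  shows "cos q - sin q / (2 * q) * (u\<^sup>2 - q\<^sup>2) \<le> cos u"
  using square_tangent[where \<psi> = cos and D = "\<lambda>x. - sin x" and B = pi and q = q and u = u]
    assms sin_mult_le by (force intro!: derivative_eq_intros)

text \<open>The product decreases from its value at 0 because \<open>x * cos x \<le> sin x\<close>.
  The factor supplies the quadratic gain in \<open>spherical_median\<close>.\<close>

lemma cos_mult_le_1:
  fixes u :: real
  assumes "0 \<le> u" "u \<le> pi"
  shows "cos u * (1 + u\<^sup>2 / 2) \<le> 1"
proof -
  have "cos u * (1 + u\<^sup>2 / 2) \<le> cos 0 * (1 + 0\<^sup>2 / 2)"
  proof (rule DERIV_nonpos_imp_nonincreasing[OF assms(1)])
    fix x :: real assume x: "0 \<le> x" "x \<le> u"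
    have "x * cos x \<le> sin x" using x assms by (intro mult_cos_le_sin) auto
    moreover have "0 \<le> sin x * (x\<^sup>2 / 2)"
      using x assms by (intro mult_nonneg_nonneg sin_ge_zero) auto
    ultimately have "- sin x * (1 + x\<^sup>2 / 2) + x * cos x \<le> 0"
      by (simp add: algebra_simps)
    then show "\<exists>y. ((\<lambda>u. cos u * (1 + u\<^sup>2 / 2)) has_real_derivative y) (at x) \<and> y \<le> 0"
      by (intro exI[of _ "- sin x * (1 + x\<^sup>2 / 2) + x * cos x"])
        (auto intro!: derivative_eq_intros)
  qed
  then show ?thesis by simp
qed

text \<open>The hypothesis \<open>le\<close> is the median formula of the sphere as an inequality.
  Replacing \<open>b\<close> and \<open>c\<close> by their quadratic mean \<open>q\<close> gives
  \<open>cos q \<le> cos (a / 2) * cos m\<close>; the factor \<open>cos (a / 2)\<close> forces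
  \<open>cos m\<close> above \<open>cos q\<close> by a multiple of the square of \<open>a\<close>,
  and a tangent turns the difference of cosines into one of squares.\<close>

lemma spherical_median:
  fixes m b c a D :: real
  assumes m: "0 \<le> m" "m \<le> pi" and bc: "0 \<le> b" "b \<le> D" "0 \<le> c" "c \<le> D"
    and a: "0 \<le> a" "a \<le> D" and D: "D < pi / 2"
    and le: "cos b + cos c \<le> 2 * cos (a / 2) * cos m"
  shows "m\<^sup>2 \<le> (b\<^sup>2 + c\<^sup>2) / 2 - cos D / 4 * a\<^sup>2"
proof -
  define q where "q = sqrt ((b\<^sup>2 + c\<^sup>2) / 2)"
  have q2: "q\<^sup>2 = (b\<^sup>2 + c\<^sup>2) / 2" and q0: "0 \<le> q"
    by (auto simp: q_def)
  have "b\<^sup>2 \<le> D\<^sup>2" "c\<^sup>2 \<le> D\<^sup>2" using bc by (auto intro: power_mono)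
  then have "q\<^sup>2 \<le> D\<^sup>2" using q2 by simp
  moreover have "0 \<le> D" using bc by linarith
  ultimately have qD: "q \<le> D" by (rule power2_le_imp_le)
  have "2 * cos q \<le> cos b + cos c"
  proof (cases "q = 0")
    case True
    then have "b = 0 \<and> c = 0" using q2 by (simp add: sum_power2_eq_zero_iff)
    then show ?thesis using True by simp
  next
    case False
    \<comment> \<open>Summing the tangents at \<open>q\<close> cancels the linear terms, since the
      square of \<open>q\<close> is the mean of the squares of \<open>b\<close> and
      \<open>c\<close>.\<close>
    have "cos q - sin q / (2 * q) * (b\<^sup>2 - q\<^sup>2) \<le> cos b"
         "cos q - sin q / (2 * q) * (c\<^sup>2 - q\<^sup>2) \<le> cos c"
      using False q0 qD bc D by (intro cos_tangent; simp)+
    moreover have "sin q / (2 * q) * (b\<^sup>2 - q\<^sup>2) + sin q / (2 * q) * (c\<^sup>2 - q\<^sup>2)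
        = sin q / (2 * q) * (b\<^sup>2 + c\<^sup>2 - 2 * q\<^sup>2)"
      by (simp only: distrib_left[symmetric]) simp
    moreover have "b\<^sup>2 + c\<^sup>2 - 2 * q\<^sup>2 = 0" using q2 by simp
    ultimately show ?thesis by simp
  qed
  with le have 1: "cos q \<le> cos (a / 2) * cos m" by simp
  have cD: "0 < cos D" "cos D \<le> cos q"
    using D bc qD q0 by (auto intro!: cos_gt_zero_pi cos_monotone_0_pi_le)
  have ca: "0 < cos (a / 2)" using a D by (intro cos_gt_zero_pi) auto
  have cm: "0 < cos m" using 1 cD ca by (smt (verit) mult_nonneg_nonpos)
  have "cos q * (1 + (a / 2)\<^sup>2 / 2) \<le> cos (a / 2) * cos m * (1 + (a / 2)\<^sup>2 / 2)"
    using 1 by (intro mult_right_mono) auto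
  also have "\<dots> = (cos (a / 2) * (1 + (a / 2)\<^sup>2 / 2)) * cos m" by simp
  also have "\<dots> \<le> 1 * cos m"
    using a D cm by (intro mult_right_mono cos_mult_le_1) auto
  finally have "cos q * (a\<^sup>2 / 8) \<le> cos m - cos q" by (simp add: algebra_simps power2_eq_square)
  moreover have "cos D * (a\<^sup>2 / 8) \<le> cos q * (a\<^sup>2 / 8)"
    using cD by (intro mult_right_mono) auto
  ultimately have 2: "cos D * (a\<^sup>2 / 8) \<le> cos m - cos q" by simp
  moreover have "0 \<le> cos D * (a\<^sup>2 / 8)" using cD by simp
  ultimately have "m \<le> q" using cos_mono_le_eq[of q m] m q0 qD D by simp
  \<comment> \<open>The tangent at \<open>m\<close> has slope at most 1/2 in absolute value;
    \<open>cos_ge_one_minus\<close> is its limiting form at \<open>m = 0\<close>.\<close>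
  have "cos m - cos q \<le> (q\<^sup>2 - m\<^sup>2) / 2"
  proof (cases "m = 0")
    case True
    then show ?thesis using cos_ge_one_minus[of q] by simp
  next
    case False
    have "cos m - sin m / (2 * m) * (q\<^sup>2 - m\<^sup>2) \<le> cos q"
      using False m q0 qD D by (intro cos_tangent) auto
    moreover have "sin m / (2 * m) * (q\<^sup>2 - m\<^sup>2) \<le> 1 / 2 * (q\<^sup>2 - m\<^sup>2)"
      using False m sin_x_le_x[of m] power_mono[OF \<open>m \<le> q\<close>, of 2]
      by (intro mult_right_mono) (auto simp: field_simps)
    ultimately show ?thesis by simp
  qed
  then have "cos D * (a\<^sup>2 / 8) \<le> (q\<^sup>2 - m\<^sup>2) / 2" using 2 by linarith
  then show ?thesis unfolding q2 by (simp add: field_simps)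
qed

text \<open>Here \<open>s\<close> is the cosine of the angle between \<open>a\<close> and
  \<open>b\<close>. With \<open>u\<close> the square root of the left-hand side,
  \<open>cos c \<le> cos u\<close> suffices; the tangent of \<open>cos\<close> at \<open>b\<close>
  reduces this to \<open>(- s) * sin b * (a - sin a) \<le> cos b * (1 - cos a)\<close>.\<close>

lemma spherical_obtuse:
  fixes a b c s :: real
  assumes a: "0 < a" "a < pi / 2" and b: "0 < b" "b < pi / 2" and c: "0 \<le> c" "c < pi / 2"
    and s: "- 1 \<le> s" "s \<le> 0"
    and law: "cos c = cos a * cos b + sin a * sin b * s"
  shows "b\<^sup>2 - 2 * a * b * s \<le> c\<^sup>2"
proof -
  define u where "u = sqrt (b\<^sup>2 - 2 * a * b * s)"
  have abs0: "a * b * s \<le> 0" using a b s by (simp add: mult_nonneg_nonpos)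
  then have "0 \<le> b\<^sup>2 - 2 * (a * b * s)" using zero_le_power2[of b] by linarith
  then have u2: "u\<^sup>2 = b\<^sup>2 - 2 * a * b * s" and u0: "0 \<le> u"
    by (auto simp: u_def mult.assoc)
  have "- (2 * a * b * s) \<le> 2 * a * b * 1"
    using a b s mult_left_mono[of "-s" 1 "2 * a * b"] by simp
  then have "u\<^sup>2 \<le> b\<^sup>2 + 2 * a * b" using u2 by simp
  also have "\<dots> \<le> (a + b)\<^sup>2" by (simp add: power2_eq_square algebra_simps)
  finally have "u \<le> a + b" using a b by (simp add: abs_le_square_iff[symmetric] u0)
  then have upi: "u \<le> pi" using a b by simp
  \<comment> \<open>The side \<open>c\<close> being shorter than a quarter circle limits how
    negative \<open>s\<close> can be.\<close>
  have "0 < cos c" using c by (intro cos_gt_zero_pi) auto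
  then have "(- s) * (sin a * sin b) \<le> cos a * cos b" using law by (simp add: algebra_simps)
  moreover have sa: "0 < sin a" "0 < sin b" "0 < cos b"
    using a b by (auto intro: sin_gt_zero cos_gt_zero_pi)
  moreover have "a \<le> pi" using a by simp
  then have "a * cos a \<le> sin a" using mult_cos_le_sin a by simp
  moreover have "sin a \<le> a" using a by (simp add: sin_x_le_x)
  ultimately have "(- s) * (sin a * sin b) * (a - sin a) \<le> cos a * cos b * (a - sin a)"
    by (intro mult_right_mono) auto
  also have "\<dots> = cos b * (a * cos a - sin a * cos a)" by (simp add: algebra_simps)
  also have "\<dots> \<le> cos b * (sin a - sin a * cos a)"
    using \<open>a * cos a \<le> sin a\<close> sa by (intro mult_left_mono) auto
  finally have "sin a * ((- s) * sin b * (a - sin a)) \<le> sin a * (cos b * (1 - cos a))"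
    by (simp add: algebra_simps)
  then have "(- s) * sin b * (a - sin a) \<le> cos b * (1 - cos a)"
    using sa(1) by (rule mult_left_le_imp_le)
  then have "cos c \<le> cos b - sin b / (2 * b) * (- (2 * a * b * s))"
    using law b by (simp add: field_simps)
  also have "\<dots> = cos b - sin b / (2 * b) * (u\<^sup>2 - b\<^sup>2)" by (simp add: u2)
  also have "\<dots> \<le> cos u" using b u0 upi by (intro cos_tangent) auto
  finally have "u \<le> c" using c u0 upi cos_mono_le_eq[of c u] by simp
  then show ?thesis using u0 u2 power_mono[of u c 2] by simp
qed


text \<open>First variation along the side \<open>b\<close>: the hypothesis on \<open>d\<close> makes the comparison angle
  between the sides \<open>a\<close> and \<open>b\<close> obtuse, and then \<open>spherical_obtuse\<close> bounds \<open>c\<close> from below.\<close>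

lemma spherical_first_variation:
  fixes a b c D :: real and d :: "real \<Rightarrow> real"
  assumes a: "0 \<le> a" "a < pi / 2" and b: "0 < b" "b < pi / 2" and c: "0 \<le> c" "c < pi / 2"
    and tri: "\<bar>a - b\<bar> \<le> c" "c \<le> a + b" and D: "0 \<le> D"
    and d: "\<And>t. 0 < t \<Longrightarrow> t \<le> 1 \<Longrightarrow> 0 \<le> d t" "\<And>t. 0 < t \<Longrightarrow> t \<le> 1 \<Longrightarrow> d t \<le> pi"
    and cmp: "\<And>t. 0 < t \<Longrightarrow> t \<le> 1 \<Longrightarrow>
       sin ((1 - t) * b) * cos a + sin (t * b) * cos c \<le> sin b * cos (d t)"
    and le: "\<And>t. 0 < t \<Longrightarrow> t \<le> 1 \<Longrightarrow> t * D \<le> (d t)\<^sup>2 - a\<^sup>2"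
  shows "D \<le> c\<^sup>2 - b\<^sup>2"
proof -
  have sb: "0 < sin b" using b by (intro sin_gt_zero) auto
  have split: "sin ((1 - t) * b) = sin b * cos (t * b) - cos b * sin (t * b)" for t
    using sin_diff[of b "t * b"] by (simp add: algebra_simps)
  \<comment> \<open>The cosine \<open>s\<close> is any solution of the law of cosines in
    \<open>[-1, 1]\<close>. For \<open>a = 0\<close> the angle is undefined and \<open>s = 0\<close>
    is chosen below.\<close>
  have slope: "D \<le> - 2 * a * b * s"
    if s: "- 1 \<le> s" "s \<le> 1" and law: "cos c = cos a * cos b + sin a * sin b * s" for s
  proof -
    have "D - (- 2 * a * b * s) \<le> t * b\<^sup>2" if t: "0 < t" "t \<le> 1" for t
    proof -
      define h where "h = t * b"
      have h: "0 < h" "h \<le> b" using t b by (auto simp: h_def mult_left_le_one_le)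
      \<comment> \<open>\<open>u\<close> is the Euclidean side opposite the angle with cosine
        \<open>s\<close> between \<open>a\<close> and \<open>h\<close>. The spherical side is not
        longer than \<open>u\<close>, and \<open>d t\<close> is not longer than the spherical
        side.\<close>
      define u where "u = sqrt (a\<^sup>2 + h\<^sup>2 - 2 * a * h * s)"
      have ah: "0 \<le> 2 * a * h" using a h by simp
      have 1: "2 * a * h * s \<le> 2 * a * h" and 2: "- (2 * a * h) \<le> 2 * a * h * s"
        using mult_left_mono[OF s(2) ah] mult_left_mono[OF s(1) ah] by simp_all
      have "(a - h)\<^sup>2 \<le> a\<^sup>2 + h\<^sup>2 - 2 * a * h * s" using 1 by (simp add: power2_diff)
      moreover from this have "0 \<le> a\<^sup>2 + h\<^sup>2 - 2 * a * h * s"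
        using zero_le_power2[of "a - h"] by linarith
      ultimately have u2: "u\<^sup>2 = a\<^sup>2 + h\<^sup>2 - 2 * a * h * s" and u0: "0 \<le> u"
        and ul: "\<bar>a - h\<bar> \<le> u"
        by (auto simp: u_def intro!: real_le_rsqrt)
      have "u\<^sup>2 \<le> (a + h)\<^sup>2" using 2 u2 by (simp add: power2_sum)
      then have uu: "u \<le> a + h" using power2_le_imp_le[of u "a + h"] a h by simp
      have ahpi: "a + h \<le> pi" using a b h by simp
      have "sin b * (cos a * cos h + sin a * sin h * s)
          = sin ((1 - t) * b) * cos a + sin (t * b) * cos c"
        unfolding law split h_def by (simp add: algebra_simps)
      also have "\<dots> \<le> sin b * cos (d t)" using cmp t by simp
      finally have cd: "cos a * cos h + sin a * sin h * s \<le> cos (d t)" using sb by simp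
      have "cos u \<le> cos (d t)"
      proof (cases "a = 0")
        case True
        then have "u = h" using u2 u0 h by (simp add: power2_eq_iff_nonneg)
        then show ?thesis using cd True by simp
      next
        case False
        have "2 * a * h * (cos u - cos a * cos h) \<le> sin a * sin h * (a\<^sup>2 + h\<^sup>2 - u\<^sup>2)"
          using a h ahpi ul uu by (intro cos_law_ge_euclidean) auto
        also have "\<dots> = 2 * a * h * (sin a * sin h * s)" by (simp add: u2)
        finally have "cos u - cos a * cos h \<le> sin a * sin h * s"
          using False a h by simp
        then show ?thesis using cd by simp
      qed
      then have "d t \<le> u"
        using cos_mono_le_eq[of u "d t"] u0 uu ahpi d t by simp
      then have "(d t)\<^sup>2 \<le> u\<^sup>2" using d t by (intro power_mono) auto
      then have "t * D \<le> h\<^sup>2 - 2 * a * h * s" using le[OF t] u2 by simp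
      then have "t * D \<le> t * (t * b\<^sup>2 - 2 * a * b * s)"
        by (simp add: h_def power2_eq_square algebra_simps)
      then show ?thesis using t by simp
    qed
    then have "D - (- 2 * a * b * s) \<le> 0" by (rule le_zero_if_le_mult_small)
    then show ?thesis by simp
  qed
  show ?thesis
  proof (cases "a = 0")
    case True
    then have "c = b" using tri b by simp
    then show ?thesis using slope[of 0] True by simp
  next
    case False
    then have sa: "0 < sin a" using a by (intro sin_gt_zero) auto
    define s where "s = (cos c - cos a * cos b) / (sin a * sin b)"
    have law: "cos c = cos a * cos b + sin a * sin b * s"
      using sa sb by (simp add: s_def)
    have "cos (a + b) \<le> cos c" using a b c tri by (intro cos_monotone_0_pi_le) auto
    moreover have "cos c \<le> cos \<bar>a - b\<bar>" using a b c tri by (intro cos_monotone_0_pi_le) auto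
    ultimately have s: "- 1 \<le> s" "s \<le> 1"
      using sa sb by (auto simp: s_def field_simps cos_add cos_diff)
    \<comment> \<open>Because \<open>D\<close> is nonnegative, the slope bound makes the angle
      obtuse.\<close>
    have *: "D \<le> - 2 * a * b * s" using slope s law by blast
    then have "(a * b) * s \<le> 0" using D by simp
    then have "s \<le> 0" using False a b by (simp add: mult_le_0_iff)
    then have "b\<^sup>2 - 2 * a * b * s \<le> c\<^sup>2"
      using False a b c s law by (intro spherical_obtuse) auto
    with * show ?thesis by simp
  qed
qed

section \<open>Comparison with the model surfaces\<close>

lemma min_geodesicD:
  assumes "min_geodesic UNIV dist y z g" "t \<in> {0..1}"
  shows "dist y (g t) = t * dist y z" "dist (g t) z = (1 - t) * dist y z"
proof -
  have ends: "g 0 = y" "g 1 = z"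
    and d: "\<And>u v. u \<in> {0..1} \<Longrightarrow> v \<in> {0..1} \<Longrightarrow> dist (g u) (g v) = \<bar>u - v\<bar> * dist y z"
    using assms(1) unfolding min_geodesic_def by blast+
  show "dist y (g t) = t * dist y z" "dist (g t) z = (1 - t) * dist y z"
    using d[of 0 t] d[of t 1] assms(2) by (simp_all add: ends)
qed

lemma comparison_le:
  assumes "alexandrov_le \<kappa> TYPE('a::metric_space)"
    and "\<kappa> > 0 \<Longrightarrow> dist x y + dist y z + dist z x < 2 * pi / sqrt \<kappa>"
    and "min_geodesic UNIV dist y (z::'a) g" "t \<in> {0..1}"
    and "x' \<in> model_space \<kappa>" "y' \<in> model_space \<kappa>" "z' \<in> model_space \<kappa>"
    and "model_dist \<kappa> x' y' = dist x y" "model_dist \<kappa> y' z' = dist y z"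
      "model_dist \<kappa> z' x' = dist z x"
    and "min_geodesic (model_space \<kappa>) (model_dist \<kappa>) y' z' g'"
  shows "dist (g t) x \<le> model_dist \<kappa> (g' t) x'"
  using assms unfolding alexandrov_le_def by blast

text \<open>A comparison triangle is written down with \<open>y\<close> at the origin,
  \<open>z\<close> on the first axis and \<open>x\<close> at angle cosine \<open>C\<close>.
  Stewart's identity evaluates the planar distance. Degenerate sides, for which \<open>C\<close> is
  undefined, are treated directly.\<close>

lemma euclidean_comparison:
  fixes x y z :: "'a::metric_space"
  assumes alex: "alexandrov_le 0 TYPE('a)" and g: "min_geodesic UNIV dist y z g" and t: "t \<in> {0..1}"
  shows "(dist x (g t))\<^sup>2
    \<le> (1 - t) * (dist x y)\<^sup>2 + t * (dist x z)\<^sup>2 - t * (1 - t) * (dist y z)\<^sup>2"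
proof (cases "dist y z = 0 \<or> dist x y = 0")
  case True
  then show ?thesis
  proof
    assume "dist y z = 0"
    then show ?thesis using min_geodesicD[OF g t] by (simp add: algebra_simps)
  next
    assume "dist x y = 0"
    then show ?thesis
      using min_geodesicD[OF g t] by (simp add: algebra_simps power2_eq_square)
  qed
next
  case False
  define a b c where "a = dist y z" and "b = dist x y" and "c = dist x z"
  have a: "0 < a" and b: "0 < b" and c: "0 \<le> c" using False by (auto simp: a_def b_def c_def)
  have tri: "\<bar>a - b\<bar> \<le> c" "c \<le> a + b"
    unfolding a_def b_def c_def by metric+
  define C where "C = (a\<^sup>2 + b\<^sup>2 - c\<^sup>2) / (2 * a * b)"
  have c2: "c\<^sup>2 = a\<^sup>2 + b\<^sup>2 - 2 * a * b * C" using a b by (simp add: C_def)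
  have "(a - b)\<^sup>2 \<le> c\<^sup>2" using power_mono[OF tri(1), of 2] by simp
  moreover have "c\<^sup>2 \<le> (a + b)\<^sup>2" using power_mono[OF tri(2) c, of 2] by simp
  ultimately have "\<bar>C\<bar> \<le> 1"
    using a b unfolding abs_le_iff by (simp add: C_def field_simps power2_diff power2_sum)
  then have "C\<^sup>2 \<le> 1" by (simp add: abs_square_le_1)
  define S where "S = sqrt (1 - C\<^sup>2)"
  have CS: "C\<^sup>2 + S\<^sup>2 = 1" using \<open>C\<^sup>2 \<le> 1\<close> by (simp add: S_def)
  define g' where "g' = (\<lambda>s::real. (s * a, 0::real, 0::real))"
  have dist0: "model_dist 0 (u, v, 0) (u', v', 0) = sqrt ((u - u')\<^sup>2 + (v - v')\<^sup>2)" for u v u' v'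
    by (simp add: model_dist_def)
  have [simp]: "(u, v, 0) \<in> model_space 0" for u v by (simp add: model_space_def)
  have "(s * a - b * C)\<^sup>2 + (b * S)\<^sup>2 = (s * a)\<^sup>2 - 2 * s * a * b * C + b\<^sup>2 * (C\<^sup>2 + S\<^sup>2)" for s
    by (simp add: power2_eq_square algebra_simps)
  then have dg: "(s * a - b * C)\<^sup>2 + (b * S)\<^sup>2 = (s * a)\<^sup>2 - 2 * s * a * b * C + b\<^sup>2" for s
    using CS by simp
  have "dist (g t) x \<le> model_dist 0 (g' t) (b * C, b * S, 0)"
  proof (rule comparison_le[OF alex _ g t])
    show "min_geodesic (model_space 0) (model_dist 0) (0, 0, 0) (a, 0, 0) g'"
      using a by (auto simp: min_geodesic_def g'_def dist0 left_diff_distrib[symmetric] abs_mult)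
    show "model_dist 0 (b * C, b * S, 0) (0, 0, 0) = dist x y"
      using dg[of 0] b by (simp add: dist0 b_def)
    show "model_dist 0 (0, 0, 0) (a, 0, 0) = dist y z" by (simp add: dist0 a_def)
    show "model_dist 0 (a, 0, 0) (b * C, b * S, 0) = dist z x"
    proof -
      have "(a - b * C)\<^sup>2 + (b * S)\<^sup>2 = c\<^sup>2" using dg[of 1] c2 by simp
      then show ?thesis using c by (simp add: dist0 c_def dist_commute)
    qed
  qed auto
  also have "\<dots> = sqrt ((t * a)\<^sup>2 - 2 * t * a * b * C + b\<^sup>2)"
    unfolding g'_def dist0 using dg[of t] by simp
  finally have "(dist x (g t))\<^sup>2 \<le> (t * a)\<^sup>2 - 2 * t * a * b * C + b\<^sup>2"
    by (simp add: dist_commute sqrt_ge_absD)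
  also have "\<dots> = (1 - t) * b\<^sup>2 + t * c\<^sup>2 - t * (1 - t) * a\<^sup>2"
    unfolding c2 by (simp add: power2_eq_square algebra_simps)
  finally show ?thesis by (simp add: a_def b_def c_def)
qed

text \<open>Lengths are rescaled to the unit sphere, \<open>y\<close> is placed at the pole,
  \<open>z\<close> on a meridian, and \<open>x\<close> at polar angle \<open>b\<close>. Multiplying
  the cosine law for the point at parameter \<open>t\<close> by \<open>sin a\<close> gives the
  Stewart form, which is linear in \<open>cos b\<close> and \<open>cos c\<close>.\<close>

lemma spherical_comparison:
  fixes x y z :: "'a::metric_space"
  assumes alex: "alexandrov_le \<kappa> TYPE('a)" and \<kappa>: "\<kappa> > 0"
    and g: "min_geodesic UNIV dist y z g" and t: "t \<in> {0..1}"
    and lt: "sqrt \<kappa> * dist y z < pi / 2" "sqrt \<kappa> * dist x y < pi / 2" "sqrt \<kappa> * dist x z < pi / 2"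
  shows "sin ((1 - t) * (sqrt \<kappa> * dist y z)) * cos (sqrt \<kappa> * dist x y)
      + sin (t * (sqrt \<kappa> * dist y z)) * cos (sqrt \<kappa> * dist x z)
    \<le> sin (sqrt \<kappa> * dist y z) * cos (sqrt \<kappa> * dist x (g t))"
proof -
  define r where "r = sqrt \<kappa>"
  define a b c where "a = r * dist y z" and "b = r * dist x y" and "c = r * dist x z"
  have r: "0 < r" "\<kappa> = r\<^sup>2" using \<kappa> by (auto simp: r_def)
  have abc: "0 \<le> a" "0 \<le> b" "0 \<le> c" "a < pi / 2" "b < pi / 2" "c < pi / 2"
    using lt r(1) by (auto simp: a_def b_def c_def r_def[symmetric])
  have split: "sin ((1 - t) * a) = sin a * cos (t * a) - cos a * sin (t * a)" for t
    using sin_diff[of a "t * a"] by (simp add: algebra_simps)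
  have "sin ((1 - t) * a) * cos b + sin (t * a) * cos c \<le> sin a * cos (r * dist x (g t))"
  proof (cases "a = 0 \<or> b = 0")
    case True
    then show ?thesis
    proof
      assume "a = 0"
      then show ?thesis by simp
    next
      assume b: "b = 0"
      then have "x = y" using r by (simp add: b_def)
      then have "r * dist x (g t) = t * a" "c = a"
        using min_geodesicD[OF g t] by (simp_all add: a_def c_def)
      then show ?thesis using b split[of t] by simp
    qed
  next
    case False
    then have sab: "0 < sin a" "0 < sin b"
      using abc by (auto intro!: sin_gt_zero)
    have "dist x z \<le> dist x y + dist y z" "\<bar>dist y z - dist x y\<bar> \<le> dist x z" by metric+
    from mult_left_mono[OF this(1), of r] mult_left_mono[OF this(2), of r]
    have tri: "\<bar>a - b\<bar> \<le> c" "c \<le> a + b"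
      using r unfolding a_def b_def c_def right_diff_distrib[symmetric] abs_mult
      by (simp_all add: algebra_simps)
    \<comment> \<open>The cosine of the angle at \<open>y\<close>; the triangle inequalities put it
      in \<open>[-1, 1]\<close>, so that \<open>S\<close> can serve as its sine.\<close>
    define C where "C = (cos c - cos a * cos b) / (sin a * sin b)"
    have law: "cos c = cos a * cos b + sin a * sin b * C" using sab by (simp add: C_def)
    have "cos (a + b) \<le> cos c" using abc tri by (intro cos_monotone_0_pi_le) auto
    moreover have "cos c \<le> cos \<bar>a - b\<bar>" using abc tri by (intro cos_monotone_0_pi_le) auto
    ultimately have "\<bar>C\<bar> \<le> 1"
      using sab unfolding abs_le_iff by (simp add: C_def field_simps cos_add cos_diff)
    then have C2: "C\<^sup>2 \<le> 1" by (simp add: abs_square_le_1)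
    define S where "S = sqrt (1 - C\<^sup>2)"
    have CS: "C\<^sup>2 + S\<^sup>2 = 1" using C2 by (simp add: S_def)
    define P where "P = (\<lambda>u v w. (u / r, v / r, w / r))"
    have P_mem: "P u v w \<in> model_space \<kappa>" if "u\<^sup>2 + v\<^sup>2 + w\<^sup>2 = 1" for u v w
    proof -
      have "(u / r)\<^sup>2 + (v / r)\<^sup>2 + (w / r)\<^sup>2 = (u\<^sup>2 + v\<^sup>2 + w\<^sup>2) / r\<^sup>2"
        by (simp add: power_divide add_divide_distrib)
      then show ?thesis using that r by (simp add: P_def model_space_def)
    qed
    have P_dist: "model_dist \<kappa> (P u v w) (P u' v' w') = arccos (u * u' + v * v' + w * w') / r"
      for u v w u' v' w'
    proof -
      have "\<kappa> * (u / r * (u' / r) + v / r * (v' / r) + w / r * (w' / r)) = u * u' + v * v' + w * w'"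
        using r by (simp add: field_simps power2_eq_square)
      then show ?thesis using \<kappa> by (simp add: P_def model_dist_def r_def)
    qed
    define g' where "g' = (\<lambda>s. P (sin (s * a)) 0 (cos (s * a)))"
    define x' where "x' = P (sin b * C) (sin b * S) (cos b)"
    have x': "x' \<in> model_space \<kappa>" unfolding x'_def
    proof (rule P_mem)
      have "(sin b * C)\<^sup>2 + (sin b * S)\<^sup>2 = (sin b)\<^sup>2 * (C\<^sup>2 + S\<^sup>2)"
        by (simp add: power_mult_distrib algebra_simps)
      then show "(sin b * C)\<^sup>2 + (sin b * S)\<^sup>2 + (cos b)\<^sup>2 = 1" using CS by simp
    qed
    have g'_mem: "g' s \<in> model_space \<kappa>" for s
      unfolding g'_def by (rule P_mem) simp
    have g'_dist: "model_dist \<kappa> (g' s) (g' s') = \<bar>s - s'\<bar> * dist y z"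
      if "s \<in> {0..1}" "s' \<in> {0..1}" for s s'
    proof -
      have "\<bar>s - s'\<bar> * a \<le> 1 * a" using that abc by (intro mult_right_mono) auto
      then have "arccos (cos (\<bar>s - s'\<bar> * a)) = \<bar>s - s'\<bar> * a"
        using abc by (intro arccos_cos) auto
      moreover have "cos (\<bar>s - s'\<bar> * a) = cos (s * a - s' * a)"
        using cos_abs_real[of "s * a - s' * a"] abc
        by (simp add: left_diff_distrib[symmetric] abs_mult del: cos_abs_real)
      ultimately have "arccos (cos (s * a - s' * a)) = \<bar>s - s'\<bar> * a" by simp
      then show ?thesis
        using r(1) by (simp add: g'_def P_dist cos_diff a_def algebra_simps)
    qed
    have g'_x': "model_dist \<kappa> (g' s) x' = arccos (cos b * cos (s * a) + sin b * sin (s * a) * C) / r" for s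
      by (simp add: g'_def x'_def P_dist algebra_simps)
    have "dist (g t) x \<le> model_dist \<kappa> (g' t) x'"
    proof (rule comparison_le[OF alex _ g t x' g'_mem g'_mem])
      have "a + b + c < 2 * pi" using abc by simp
      then have "r * (dist x y + dist y z + dist z x) < 2 * pi"
        by (simp add: a_def b_def c_def dist_commute algebra_simps)
      then show "dist x y + dist y z + dist z x < 2 * pi / sqrt \<kappa>"
        using r(1) by (simp add: r_def[symmetric] field_simps)
      show "min_geodesic (model_space \<kappa>) (model_dist \<kappa>) (g' 0) (g' 1) g'"
        using g'_mem g'_dist by (auto simp: min_geodesic_def)
      show "model_dist \<kappa> (g' 0) (g' 1) = dist y z" using g'_dist[of 0 1] by simp
      show "model_dist \<kappa> x' (g' 0) = dist x y"
        using abc r(1) by (simp add: g'_def x'_def P_dist arccos_cos b_def)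
      show "model_dist \<kappa> (g' 1) x' = dist z x"
        using abc r(1) law[symmetric] by (simp add: g'_x' algebra_simps arccos_cos c_def dist_commute)
    qed
    then have "r * dist x (g t) \<le> arccos (cos b * cos (t * a) + sin b * sin (t * a) * C)"
      using r(1) by (simp add: g'_x' field_simps dist_commute)
    \<comment> \<open>Needed for \<open>cos\<close> to undo \<open>arccos\<close>.\<close>
    moreover have "\<bar>cos b * cos (t * a) + sin b * sin (t * a) * C\<bar> \<le> 1"
    proof -
      have ta: "0 \<le> t * a" "t * a \<le> 1 * a" using t abc by (simp_all add: mult_left_le_one_le)
      then have "0 \<le> sin b * sin (t * a)" using sab abc by (auto intro!: mult_nonneg_nonneg sin_ge_zero)
      then have "\<bar>sin b * sin (t * a) * C\<bar> \<le> sin b * sin (t * a)"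
        using mult_left_le[OF \<open>\<bar>C\<bar> \<le> 1\<close>] abs_mult[of "sin b * sin (t * a)" C] by simp
      moreover have "cos b * cos (t * a) + sin b * sin (t * a) \<le> 1"
        using cos_le_one[of "b - t * a"] by (simp add: cos_diff)
      moreover have "- 1 \<le> cos b * cos (t * a) - sin b * sin (t * a)"
        using cos_ge_minus_one[of "b + t * a"] by (simp add: cos_add)
      ultimately show ?thesis by linarith
    qed
    ultimately have "cos b * cos (t * a) + sin b * sin (t * a) * C \<le> cos (r * dist x (g t))"
      using r cos_monotone_0_pi_le[of "r * dist x (g t)"]
      by (smt (verit) arccos_ubound cos_arccos_abs zero_le_dist mult_nonneg_nonneg abs_le_iff)
    then have "sin a * (cos b * cos (t * a) + sin b * sin (t * a) * C) \<le> sin a * cos (r * dist x (g t))"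
      using sab by simp
    then show ?thesis unfolding split law by (simp add: algebra_simps)
  qed
  then show ?thesis by (simp add: r_def a_def b_def c_def)
qed

text \<open>The construction of the sphere on the hyperboloid, with \<open>y\<close> at its apex.
  The comparison distance is an \<open>arcosh\<close>, and \<open>cosh\<close> preserves the order
  of nonnegative lengths, so the inequality points the other way.\<close>

lemma hyperbolic_comparison:
  fixes x y z :: "'a::metric_space"
  assumes alex: "alexandrov_le \<kappa> TYPE('a)" and \<kappa>: "\<kappa> < 0"
    and g: "min_geodesic UNIV dist y z g" and t: "t \<in> {0..1}"
  shows "sinh (sqrt (- \<kappa>) * dist y z) * cosh (sqrt (- \<kappa>) * dist x (g t))
    \<le> sinh ((1 - t) * (sqrt (- \<kappa>) * dist y z)) * cosh (sqrt (- \<kappa>) * dist x y)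
      + sinh (t * (sqrt (- \<kappa>) * dist y z)) * cosh (sqrt (- \<kappa>) * dist x z)"
proof -
  define r where "r = sqrt (- \<kappa>)"
  define a b c where "a = r * dist y z" and "b = r * dist x y" and "c = r * dist x z"
  have r: "0 < r" "\<kappa> = - r\<^sup>2" using \<kappa> by (auto simp: r_def)
  have abc: "0 \<le> a" "0 \<le> b" "0 \<le> c"
    using r by (auto simp: a_def b_def c_def)
  have split: "sinh ((1 - t) * a) = sinh a * cosh (t * a) - cosh a * sinh (t * a)" for t
    using sinh_diff[of a "t * a"] by (simp add: algebra_simps)
  have "sinh a * cosh (r * dist x (g t)) \<le> sinh ((1 - t) * a) * cosh b + sinh (t * a) * cosh c"
  proof (cases "a = 0 \<or> b = 0")
    case True
    then show ?thesis
    proof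
      assume "a = 0"
      then show ?thesis by simp
    next
      assume b: "b = 0"
      then have "x = y" using r by (simp add: b_def)
      then have "r * dist x (g t) = t * a" "c = a"
        using min_geodesicD[OF g t] by (simp_all add: a_def c_def)
      then show ?thesis using b split[of t] by simp
    qed
  next
    case False
    then have sab: "0 < sinh a" "0 < sinh b"
      using abc by auto
    have "dist x z \<le> dist x y + dist y z" "\<bar>dist y z - dist x y\<bar> \<le> dist x z" by metric+
    from mult_left_mono[OF this(1), of r] mult_left_mono[OF this(2), of r]
    have tri: "\<bar>a - b\<bar> \<le> c" "c \<le> a + b"
      using r unfolding a_def b_def c_def right_diff_distrib[symmetric] abs_mult
      by (simp_all add: algebra_simps)
    define C where "C = (cosh a * cosh b - cosh c) / (sinh a * sinh b)"
    have law: "cosh c = cosh a * cosh b - sinh a * sinh b * C" using sab by (simp add: C_def)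
    have "cosh c \<le> cosh (a + b)" using abc tri by (simp add: cosh_real_nonneg_le_iff)
    moreover have "cosh \<bar>a - b\<bar> \<le> cosh c"
      using abc tri by (intro iffD2[OF cosh_real_nonneg_le_iff]) auto
    then have "cosh (a - b) \<le> cosh c"
      by (simp add: abs_if cosh_minus[of "a - b", symmetric] del: cosh_minus split: if_splits)
    ultimately have "\<bar>C\<bar> \<le> 1"
      using sab unfolding abs_le_iff by (simp add: C_def field_simps cosh_add cosh_diff)
    then have C2: "C\<^sup>2 \<le> 1" by (simp add: abs_square_le_1)
    define S where "S = sqrt (1 - C\<^sup>2)"
    have CS: "C\<^sup>2 + S\<^sup>2 = 1" using C2 by (simp add: S_def)
    define P where "P = (\<lambda>u v w. (u / r, v / r, w / r))"
    have P_mem: "P u v w \<in> model_space \<kappa>" if "u\<^sup>2 + v\<^sup>2 - w\<^sup>2 = - 1" "0 < w" for u v w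
    proof -
      have "(u / r)\<^sup>2 + (v / r)\<^sup>2 - (w / r)\<^sup>2 = (u\<^sup>2 + v\<^sup>2 - w\<^sup>2) / r\<^sup>2"
        by (simp add: power_divide add_divide_distrib diff_divide_distrib)
      then show ?thesis using that r \<kappa> by (simp add: P_def model_space_def)
    qed
    have P_dist: "model_dist \<kappa> (P u v w) (P u' v' w') = arcosh (w * w' - u * u' - v * v') / r"
      for u v w u' v' w'
    proof -
      have "\<kappa> * (u / r * (u' / r) + v / r * (v' / r) - w / r * (w' / r)) = w * w' - u * u' - v * v'"
        using r by (simp add: field_simps power2_eq_square)
      then show ?thesis
        using \<kappa> unfolding P_def model_dist_def prod.case r_def[symmetric] by simp
    qed
    define g' where "g' = (\<lambda>s. P (sinh (s * a)) 0 (cosh (s * a)))"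
    define x' where "x' = P (sinh b * C) (sinh b * S) (cosh b)"
    have x': "x' \<in> model_space \<kappa>" unfolding x'_def
    proof (rule P_mem)
      have "(sinh b * C)\<^sup>2 + (sinh b * S)\<^sup>2 = (sinh b)\<^sup>2 * (C\<^sup>2 + S\<^sup>2)"
        by (simp add: power_mult_distrib algebra_simps)
      then show "(sinh b * C)\<^sup>2 + (sinh b * S)\<^sup>2 - (cosh b)\<^sup>2 = - 1"
        using CS by (simp add: cosh_square_eq)
    qed simp
    have g'_mem: "g' s \<in> model_space \<kappa>" for s
      unfolding g'_def by (rule P_mem) (simp_all add: cosh_square_eq)
    have g'_dist: "model_dist \<kappa> (g' s) (g' s') = \<bar>s - s'\<bar> * dist y z" for s s'
    proof -
      have "arcosh (cosh (\<bar>s - s'\<bar> * a)) = \<bar>s - s'\<bar> * a"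
        using abc by (intro arcosh_cosh_real) auto
      moreover have "cosh (\<bar>s - s'\<bar> * a) = cosh (s * a - s' * a)"
        using cosh_minus[of "s * a - s' * a"] by (simp add: abs_if algebra_simps)
      ultimately have "arcosh (cosh (s * a - s' * a)) = \<bar>s - s'\<bar> * a" by simp
      then show ?thesis
        using r(1) by (simp add: g'_def P_dist cosh_diff a_def algebra_simps)
    qed
    have g'_x': "model_dist \<kappa> (g' s) x' = arcosh (cosh b * cosh (s * a) - sinh b * sinh (s * a) * C) / r" for s
      by (simp add: g'_def x'_def P_dist algebra_simps)
    have "dist (g t) x \<le> model_dist \<kappa> (g' t) x'"
    proof (rule comparison_le[OF alex _ g t x' g'_mem g'_mem])
      show "min_geodesic (model_space \<kappa>) (model_dist \<kappa>) (g' 0) (g' 1) g'"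
        using g'_mem g'_dist by (auto simp: min_geodesic_def)
      show "model_dist \<kappa> (g' 0) (g' 1) = dist y z" using g'_dist[of 0 1] by simp
      show "model_dist \<kappa> x' (g' 0) = dist x y"
        using abc r(1) by (simp add: g'_def x'_def P_dist arcosh_cosh_real b_def)
      show "model_dist \<kappa> (g' 1) x' = dist z x"
        using abc r(1) law[symmetric] by (simp add: g'_x' algebra_simps arcosh_cosh_real c_def dist_commute)
    qed (use \<kappa> in auto)
    then have le: "r * dist x (g t) \<le> arcosh (cosh b * cosh (t * a) - sinh b * sinh (t * a) * C)"
      using r(1) by (simp add: g'_x' field_simps dist_commute)
    \<comment> \<open>\<open>cosh\<close> undoes \<open>arcosh\<close> only from 1 on.\<close>
    have ge1: "1 \<le> cosh b * cosh (t * a) - sinh b * sinh (t * a) * C"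
    proof -
      have "0 \<le> sinh b * sinh (t * a)" using sab abc t by simp
      then have "sinh b * sinh (t * a) * C \<le> sinh b * sinh (t * a)"
        using \<open>\<bar>C\<bar> \<le> 1\<close> by (simp add: mult_left_le)
      then show ?thesis
        using cosh_real_ge_1[of "b - t * a"] by (simp add: cosh_diff)
    qed
    have "cosh (r * dist x (g t)) \<le> cosh (arcosh (cosh b * cosh (t * a) - sinh b * sinh (t * a) * C))"
      using le r ge1 by (subst cosh_real_nonneg_le_iff) auto
    also have "\<dots> = cosh b * cosh (t * a) - sinh b * sinh (t * a) * C"
      using ge1 by simp
    finally have "sinh a * cosh (r * dist x (g t)) \<le> sinh a * (cosh b * cosh (t * a) - sinh b * sinh (t * a) * C)"
      using sab by simp
    then show ?thesis unfolding split law by (simp add: algebra_simps)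
  qed
  then show ?thesis by (simp add: r_def a_def b_def c_def)
qed

text \<open>Negative curvature bounds imply the bound 0: the hyperbolic Stewart inequality is
  weakened to the Euclidean one. The configurations split off are those where a length appearing as
  a divisor vanishes.\<close>

lemma cat0_inequality:
  fixes x y z :: "'a::metric_space"
  assumes alex: "alexandrov_le \<kappa> TYPE('a)" and \<kappa>: "\<kappa> \<le> 0"
    and g: "min_geodesic UNIV dist y z g" and t: "t \<in> {0..1}"
  shows "(dist x (g t))\<^sup>2
    \<le> (1 - t) * (dist x y)\<^sup>2 + t * (dist x z)\<^sup>2 - t * (1 - t) * (dist y z)\<^sup>2"
proof (cases "\<kappa> = 0")
  case True
  with alex euclidean_comparison g t show ?thesis by blast
next
  case False
  with \<kappa> have neg: "\<kappa> < 0" by simp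
  note geo = min_geodesicD[OF g t]
  show ?thesis
  proof (cases "x = g t \<or> t = 0 \<or> t = 1 \<or> y = z")
    case True
    moreover have "g 0 = y" "g 1 = z" using g by (auto simp: min_geodesic_def)
    moreover have ?thesis if "x = g t"
    proof -
      have "dist x y = t * dist y z" "dist x z = (1 - t) * dist y z"
        using that geo by (simp_all add: dist_commute)
      then have "(1 - t) * (dist x y)\<^sup>2 + t * (dist x z)\<^sup>2 - t * (1 - t) * (dist y z)\<^sup>2 = 0"
        by (simp only:) (simp add: power2_eq_square algebra_simps)
      then show ?thesis using that by simp
    qed
    moreover have ?thesis if "y = z" using that geo by (simp add: algebra_simps)
    ultimately show ?thesis by auto
  next
    case False
    define r where "r = sqrt (- \<kappa>)"
    have r: "0 < r" using neg by (simp add: r_def)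
    define d h k b c where "d = r * dist x (g t)" and "h = r * dist y (g t)"
      and "k = r * dist (g t) z" and "b = r * dist x y" and "c = r * dist x z"
    have "k * (d\<^sup>2 + h\<^sup>2 - b\<^sup>2) + h * (d\<^sup>2 + k\<^sup>2 - c\<^sup>2) \<le> 0"
    proof (rule hyperbolic_stewart_le_euclidean)
      show "0 < d" "0 < h" "0 < k" using False t r geo by (auto simp: d_def h_def k_def)
      show "\<bar>d - h\<bar> \<le> b"
        using r by (simp add: d_def h_def b_def right_diff_distrib[symmetric] abs_mult) metric
      show "b \<le> d + h"
        using r by (simp add: d_def h_def b_def distrib_left[symmetric]) metric
      show "\<bar>d - k\<bar> \<le> c"
        using r by (simp add: d_def k_def c_def right_diff_distrib[symmetric] abs_mult) metric
      show "c \<le> d + k"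
        using r by (simp add: d_def k_def c_def distrib_left[symmetric]) metric
      have "h = t * (r * dist y z)" "k = (1 - t) * (r * dist y z)" "h + k = r * dist y z"
        by (simp_all add: h_def k_def geo algebra_simps)
      then show "cosh d * sinh (h + k) \<le> sinh k * cosh b + sinh h * cosh c"
        using hyperbolic_comparison[OF alex neg g t, of x]
        by (simp add: r_def[symmetric] d_def b_def c_def mult.commute)
    qed
    \<comment> \<open>Substituting the lengths of the two pieces of the geodesic exposes the claim
      times a positive factor.\<close>
    also have "k * (d\<^sup>2 + h\<^sup>2 - b\<^sup>2) + h * (d\<^sup>2 + k\<^sup>2 - c\<^sup>2)
      = r ^ 3 * dist y z * ((dist x (g t))\<^sup>2
         - ((1 - t) * (dist x y)\<^sup>2 + t * (dist x z)\<^sup>2 - t * (1 - t) * (dist y z)\<^sup>2))"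
      by (simp add: d_def h_def k_def b_def c_def geo power2_eq_square power3_eq_cube algebra_simps)
    finally show ?thesis using r False by (simp add: mult_le_0_iff)
  qed
qed

section \<open>Uniform convexity and first variation of the squared distance\<close>

definition sqdist_uniformly_convex :: "'a::metric_space set \<Rightarrow> real \<Rightarrow> bool" where
  "sqdist_uniformly_convex G k \<longleftrightarrow>
     (\<forall>x\<in>G. \<forall>y\<in>G. \<forall>z\<in>G. \<forall>g. min_geodesic UNIV dist y z g \<longrightarrow>
        (dist x (g (1 / 2)))\<^sup>2 \<le> ((dist x y)\<^sup>2 + (dist x z)\<^sup>2) / 2 - k * (dist y z)\<^sup>2)"

lemma geodesically_convexD:
  "geodesically_convex G \<Longrightarrow> y \<in> G \<Longrightarrow> z \<in> G \<Longrightarrow> min_geodesic UNIV dist y z g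
    \<Longrightarrow> t \<in> {0..1} \<Longrightarrow> g t \<in> G"
  unfolding geodesically_convex_def by blast

lemma scaled_dist_le_diameter:
  assumes "\<kappa> > 0" "bounded G" "x \<in> G" "y \<in> G"
  shows "sqrt \<kappa> * dist x y \<le> sqrt \<kappa> * diameter G"
  using assms diameter_bounded_bound[of G x y] by simp

lemma scaled_diameter_less:
  assumes "\<kappa> > 0" "diameter G < pi / (2 * sqrt \<kappa>)"
  shows "sqrt \<kappa> * diameter G < pi / 2"
  using assms by (simp add: field_simps)

text \<open>The midpoint case of comparison. The constant is the Hilbert space value 1/4 for
  \<open>\<kappa> \<le> 0\<close>, and \<open>cos D / 4\<close> for positive
  \<open>\<kappa>\<close>, where the rescaled diameter \<open>D\<close> is below
  \<open>pi / 2\<close>.\<close>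

lemma sqdist_uniformly_convex_alexandrov:
  fixes G :: "'a::metric_space set"
  assumes alex: "alexandrov_le \<kappa> TYPE('a)" and convex: "geodesically_convex G"
    and diam: "\<kappa> > 0 \<longrightarrow> bounded G \<and> diameter G < pi / (2 * sqrt \<kappa>)"
  shows "\<exists>k>0. sqdist_uniformly_convex G k"
proof (cases "\<kappa> > 0")
  case False
  have "sqdist_uniformly_convex G (1 / 4)"
    unfolding sqdist_uniformly_convex_def
  proof (intro ballI allI impI)
    fix x y z :: 'a and g assume "min_geodesic UNIV dist y z g"
    from cat0_inequality[OF alex _ this, of "1 / 2" x] False
    show "(dist x (g (1 / 2)))\<^sup>2 \<le> ((dist x y)\<^sup>2 + (dist x z)\<^sup>2) / 2 - 1 / 4 * (dist y z)\<^sup>2"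
      by (simp add: field_simps)
  qed
  then show ?thesis by (intro exI[of _ "1 / 4"]) simp
next
  case True
  define r where "r = sqrt \<kappa>"
  define D where "D = r * diameter G"
  have r: "0 < r" using True by (simp add: r_def)
  have D: "D < pi / 2" and le_D: "\<And>x y. x \<in> G \<Longrightarrow> y \<in> G \<Longrightarrow> r * dist x y \<le> D"
    using scaled_diameter_less[of \<kappa> G] scaled_dist_le_diameter[of \<kappa> G] True diam
    by (auto simp: D_def r_def)
  have "0 \<le> D" using diam True r by (simp add: D_def diameter_ge_0)
  then have "0 < cos D" using D by (intro cos_gt_zero_pi) auto
  moreover have "sqdist_uniformly_convex G (cos D / 4)"
    unfolding sqdist_uniformly_convex_def
  proof (intro ballI allI impI)
    fix x y z :: 'a and g
    assume G: "x \<in> G" "y \<in> G" "z \<in> G" and g: "min_geodesic UNIV dist y z g"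
    have gG: "g (1 / 2) \<in> G" using geodesically_convexD[OF convex _ _ g] G by simp
    define a b c m where "a = r * dist y z" and "b = r * dist x y" and "c = r * dist x z"
      and "m = r * dist x (g (1 / 2))"
    have abcm: "0 \<le> a" "0 \<le> b" "0 \<le> c" "0 \<le> m" "a \<le> D" "b \<le> D" "c \<le> D" "m \<le> D"
      using r le_D G gG by (auto simp: a_def b_def c_def m_def)
    have "m\<^sup>2 \<le> (b\<^sup>2 + c\<^sup>2) / 2 - cos D / 4 * a\<^sup>2"
    proof (cases "a = 0")
      case True
      then have "y = z" using r by (simp add: a_def)
      moreover from this have "g (1 / 2) = y" using min_geodesicD[OF g, of "1 / 2"] by simp
      ultimately show ?thesis using True by (simp add: m_def b_def c_def)
    next
      case False
      \<comment> \<open>Cancelling \<open>sin (a / 2)\<close> by the double angle formula leaves the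
        hypothesis of \<open>spherical_median\<close>.\<close>
      have "sin (1 / 2 * a) * cos b + sin (1 / 2 * a) * cos c \<le> sin a * cos m"
        using spherical_comparison[OF alex \<open>\<kappa> > 0\<close> g, of "1 / 2" x] abcm D
        by (simp add: r_def[symmetric] a_def b_def c_def m_def)
      also have "sin a = 2 * sin (a / 2) * cos (a / 2)" using sin_double[of "a / 2"] by simp
      finally have "sin (a / 2) * (cos b + cos c) \<le> sin (a / 2) * (2 * cos (a / 2) * cos m)"
        by (simp add: algebra_simps)
      moreover have "0 < sin (a / 2)" using False abcm D by (intro sin_gt_zero) auto
      ultimately have "cos b + cos c \<le> 2 * cos (a / 2) * cos m" by (rule mult_left_le_imp_le)
      then show ?thesis using abcm D by (intro spherical_median) auto
    qed
    then have "r\<^sup>2 * (dist x (g (1 / 2)))\<^sup>2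
        \<le> r\<^sup>2 * (((dist x y)\<^sup>2 + (dist x z)\<^sup>2) / 2 - cos D / 4 * (dist y z)\<^sup>2)"
      by (simp add: a_def b_def c_def m_def power_mult_distrib algebra_simps)
    then show "(dist x (g (1 / 2)))\<^sup>2 \<le> ((dist x y)\<^sup>2 + (dist x z)\<^sup>2) / 2 - cos D / 4 * (dist y z)\<^sup>2"
      using r by simp
  qed
  ultimately show ?thesis by (intro exI[of _ "cos D / 4"]) simp
qed

text \<open>In the application \<open>D\<close> is \<open>2 * lam * (u - v)\<close>. For
  \<open>\<kappa> \<le> 0\<close> the comparison inequality is divided by \<open>t\<close> and
  \<open>t\<close> tends to 0; for positive \<open>\<kappa>\<close> everything is rescaled to the
  unit sphere, which multiplies \<open>D\<close> by the square of \<open>r\<close>.\<close>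

lemma sqdist_first_variation:
  fixes G :: "'a::metric_space set"
  assumes alex: "alexandrov_le \<kappa> TYPE('a)" and convex: "geodesically_convex G"
    and diam: "\<kappa> > 0 \<longrightarrow> bounded G \<and> diameter G < pi / (2 * sqrt \<kappa>)"
    and G: "p \<in> G" "x \<in> G" "y \<in> G" and g: "min_geodesic UNIV dist p y g" and D: "0 \<le> D"
    and le: "\<And>t. t \<in> {0..1} \<Longrightarrow> t * D \<le> (dist x (g t))\<^sup>2 - (dist x p)\<^sup>2"
  shows "D \<le> (dist x y)\<^sup>2 - (dist p y)\<^sup>2"
proof (cases "\<kappa> > 0")
  case False
  have "D + (dist x p)\<^sup>2 + (dist p y)\<^sup>2 - (dist x y)\<^sup>2 \<le> t * (dist p y)\<^sup>2" if t: "0 < t" "t \<le> 1" for t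
  proof -
    have "t * D \<le> (1 - t) * (dist x p)\<^sup>2 + t * (dist x y)\<^sup>2 - t * (1 - t) * (dist p y)\<^sup>2 - (dist x p)\<^sup>2"
      using cat0_inequality[OF alex _ g, of t x] False le[of t] t by simp
    then have "t * (D + (dist x p)\<^sup>2 + (dist p y)\<^sup>2 - (dist x y)\<^sup>2) \<le> t * (t * (dist p y)\<^sup>2)"
      by (simp add: algebra_simps)
    then show ?thesis using t(1) by (rule mult_left_le_imp_le)
  qed
  from le_zero_if_le_mult_small[OF this] show ?thesis
    using zero_le_power2[of "dist x p"] by linarith
next
  case True
  define r where "r = sqrt \<kappa>"
  have r: "0 < r" using True by (simp add: r_def)
  have less: "r * dist x y < pi / 2" if "x \<in> G" "y \<in> G" for x y
    unfolding r_def
    using scaled_diameter_less[of \<kappa> G] scaled_dist_le_diameter[of \<kappa> G x y] True diam that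
    by linarith
  show ?thesis
  proof (cases "p = y")
    case True
    have "g 1 = y" using g by (simp add: min_geodesic_def)
    then have "D \<le> 0" using le[of 1] True by simp
    also have "\<dots> \<le> (dist x y)\<^sup>2" by simp
    finally show ?thesis using True by simp
  next
    case False
    have "r\<^sup>2 * D \<le> (r * dist x y)\<^sup>2 - (r * dist p y)\<^sup>2"
    proof (rule spherical_first_variation[where a = "r * dist x p" and d = "\<lambda>t. r * dist x (g t)"])
      show "r * dist x p < pi / 2" "r * dist p y < pi / 2" "r * dist x y < pi / 2"
        using less G by auto
      show "\<bar>r * dist x p - r * dist p y\<bar> \<le> r * dist x y"
        using r by (simp add: right_diff_distrib[symmetric] abs_mult) metric
      show "r * dist x y \<le> r * dist x p + r * dist p y"
        using r by (simp add: distrib_left[symmetric]) metric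
      fix t :: real assume t: "0 < t" "t \<le> 1"
      have "g t \<in> G" using geodesically_convexD[OF convex _ _ g] G t by simp
      then have "r * dist x (g t) < pi / 2" using less G by simp
      then show "r * dist x (g t) \<le> pi" using pi_gt_zero by linarith
      show "sin ((1 - t) * (r * dist p y)) * cos (r * dist x p) + sin (t * (r * dist p y)) * cos (r * dist x y)
          \<le> sin (r * dist p y) * cos (r * dist x (g t))"
        using spherical_comparison[OF alex \<open>\<kappa> > 0\<close> g, of t x] t less G by (simp add: r_def)
      have "r\<^sup>2 * (t * D) \<le> r\<^sup>2 * ((dist x (g t))\<^sup>2 - (dist x p)\<^sup>2)"
        using le[of t] t by (intro mult_left_mono) auto
      then show "t * (r\<^sup>2 * D) \<le> (r * dist x (g t))\<^sup>2 - (r * dist x p)\<^sup>2"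
        by (simp add: power_mult_distrib algebra_simps)
    qed (use r False D in auto)
    then have "r\<^sup>2 * D \<le> r\<^sup>2 * ((dist x y)\<^sup>2 - (dist p y)\<^sup>2)"
      by (simp add: power_mult_distrib algebra_simps)
    then show ?thesis using r by simp
  qed
qed

section \<open>Existence and uniqueness of the resolvent\<close>

text \<open>The projection argument of Hilbert spaces, in place of compactness. The distances from
  \<open>p\<close> to the sets increase to a limit; almost nearest points form a Cauchy sequence,
  since their midpoints stay in the larger set and cannot be much closer to
  \<open>p\<close>.\<close>

lemma nested_midconvex_Inter:
  fixes C :: "nat \<Rightarrow> 'a::metric_space set"
  assumes complete: "complete (UNIV :: 'a set)" and geodesic: "geodesic_space TYPE('a)"
    and uc: "sqdist_uniformly_convex G k" and k: "0 < k" and p: "p \<in> G"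
    and CG: "\<And>n. C n \<subseteq> G" and closed: "\<And>n. closed (C n)" and dec: "decseq C"
    and mid: "\<And>n y z g. y \<in> C n \<Longrightarrow> z \<in> C n \<Longrightarrow> min_geodesic UNIV dist y z g \<Longrightarrow> g (1 / 2) \<in> C n"
    and bdd: "\<And>n. \<exists>y\<in>C n. dist p y \<le> R"
  shows "\<exists>y. \<forall>n. y \<in> C n"
proof -
  define \<rho> where "\<rho> = (\<lambda>n. infdist p (C n))"
  have ne: "C n \<noteq> {}" for n using bdd[of n] by auto
  have sub: "m \<ge> n \<Longrightarrow> C m \<subseteq> C n" for m n using dec by (simp add: decseq_def)
  have inc: "incseq \<rho>"
    unfolding \<rho>_def incseq_def using infdist_mono[OF sub ne] by blast
  have "\<rho> n \<le> R" for n
  proof -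
    obtain y where "y \<in> C n" "dist p y \<le> R" using bdd by blast
    then show ?thesis unfolding \<rho>_def using infdist_le[of y "C n" p] by linarith
  qed
  then obtain L where L: "\<rho> \<longlonglongrightarrow> L" using incseq_convergent[OF inc] by blast
  have "\<exists>y\<in>C n. dist p y < \<rho> n + 1 / Suc n" for n
  proof -
    have "(INF y\<in>C n. dist p y) < \<rho> n + 1 / Suc n"
      using ne[of n] by (simp add: \<rho>_def infdist_def)
    from cInf_lessD[OF _ this] ne[of n] show ?thesis by auto
  qed
  then obtain y where y: "\<And>n. y n \<in> C n" "\<And>n. dist p (y n) < \<rho> n + 1 / Suc n" by metis
  have \<rho>y: "\<rho> n \<le> dist p (y n)" for n unfolding \<rho>_def using y by (intro infdist_le)
  have upper: "(\<lambda>n. \<rho> n + 1 / Suc n) \<longlonglongrightarrow> L"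
    using tendsto_add[OF L LIMSEQ_Suc[OF lim_1_over_n]] by simp
  have "(\<lambda>n. dist p (y n)) \<longlonglongrightarrow> L"
  proof (rule tendsto_sandwich[OF _ _ L upper])
    show "\<forall>\<^sub>F n in sequentially. \<rho> n \<le> dist p (y n)"
      using \<rho>y by (intro always_eventually) blast
    show "\<forall>\<^sub>F n in sequentially. dist p (y n) \<le> \<rho> n + 1 / Suc n"
      using y(2) by (intro always_eventually) (simp add: less_imp_le)
  qed
  then have lim: "(\<lambda>n. (dist p (y n))\<^sup>2) \<longlonglongrightarrow> L\<^sup>2" "(\<lambda>n. (\<rho> n)\<^sup>2) \<longlonglongrightarrow> L\<^sup>2"
    using L by (auto intro: tendsto_power)
  have close: "k * (dist (y n) (y m))\<^sup>2 \<le> ((dist p (y n))\<^sup>2 + (dist p (y m))\<^sup>2) / 2 - (\<rho> n)\<^sup>2"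
    if "n \<le> m" for n m
  proof -
    have ym: "y m \<in> C n" using y(1) sub[OF that] by blast
    obtain g where g: "min_geodesic UNIV dist (y n) (y m) g"
      using geodesic unfolding geodesic_space_def by blast
    have "\<rho> n \<le> dist p (g (1 / 2))"
      unfolding \<rho>_def using mid[OF y(1) ym g] by (rule infdist_le)
    then have "(\<rho> n)\<^sup>2 \<le> (dist p (g (1 / 2)))\<^sup>2"
      by (intro power_mono) (auto simp: \<rho>_def infdist_nonneg)
    also have "\<dots> \<le> ((dist p (y n))\<^sup>2 + (dist p (y m))\<^sup>2) / 2 - k * (dist (y n) (y m))\<^sup>2"
      using uc p y(1) CG g unfolding sqdist_uniformly_convex_def by blast
    finally show ?thesis by simp
  qed
  have "Cauchy y"
  proof (rule metric_CauchyI)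
    fix e :: real assume e: "0 < e"
    \<comment> \<open>Chosen so that the errors in \<open>close\<close>, \<open>2 * \<eta>\<close>
      in total, amount to \<open>k\<close> times the square of \<open>e\<close>.\<close>
    define \<eta> where "\<eta> = k * e\<^sup>2 / 2"
    have \<eta>: "0 < \<eta>" using e k by (simp add: \<eta>_def)
    obtain N where N: "\<And>n. n \<ge> N \<Longrightarrow> (dist p (y n))\<^sup>2 < L\<^sup>2 + \<eta>" "\<And>n. n \<ge> N \<Longrightarrow> L\<^sup>2 - \<eta> < (\<rho> n)\<^sup>2"
    proof -
      have "\<forall>\<^sub>F n in sequentially. (dist p (y n))\<^sup>2 < L\<^sup>2 + \<eta> \<and> L\<^sup>2 - \<eta> < (\<rho> n)\<^sup>2"
        using order_tendstoD(2)[OF lim(1), of "L\<^sup>2 + \<eta>"] order_tendstoD(1)[OF lim(2), of "L\<^sup>2 - \<eta>"] \<eta>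
        by (auto intro: eventually_conj)
      then show ?thesis using that by (auto simp: eventually_sequentially)
    qed
    have *: "dist (y n) (y m) < e" if "N \<le> n" "n \<le> m" for n m
    proof -
      have "k * (dist (y n) (y m))\<^sup>2 < 2 * \<eta>"
        using close[OF that(2)] N(1)[of n] N(1)[of m] N(2)[of n] that
        by (simp add: field_simps)
      then have "(dist (y n) (y m))\<^sup>2 < e\<^sup>2" using k by (simp add: \<eta>_def)
      then show ?thesis by (rule power2_less_imp_less) (use e in simp)
    qed
    show "\<exists>M. \<forall>m\<ge>M. \<forall>n\<ge>M. dist (y m) (y n) < e"
      by (intro exI[of _ N]) (metis * dist_commute nle_le)
  qed
  then obtain l where l: "y \<longlonglongrightarrow> l"
    using complete by (auto simp: complete_def)
  have "l \<in> C n" for n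
    by (rule Lim_in_closed_set[OF closed _ _ l])
      (use y(1) sub in \<open>auto simp: eventually_sequentially intro!: exI[of _ n]\<close>)
  then show ?thesis by blast
qed

text \<open>Curvature enters existence and uniqueness only through the constant \<open>k\<close> in
  \<open>uc\<close>; \<open>\<kappa>\<close> returns in \<open>resolvent_decrease\<close>.\<close>

locale convex_minimization =
  fixes f :: "'a::metric_space \<Rightarrow> ereal" and G :: "'a set" and k :: real
  assumes complete: "complete (UNIV :: 'a set)" and geodesic: "geodesic_space TYPE('a)"
    and uc: "sqdist_uniformly_convex G k" and k: "0 < k"
    and closed: "closed G" and G_convex: "geodesically_convex G"
    and f_not_minf: "f y \<noteq> -\<infinity>" and f_finite: "\<exists>y\<in>G. f y \<noteq> \<infinity>"
    and f_convex: "convex_fun f" and f_lsc: "lsc f"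
begin

lemma f_geodesic_le:
  assumes "min_geodesic UNIV dist y z g" "t \<in> {0..1}" "f y \<le> ereal u" "f z \<le> ereal v"
  shows "f (g t) \<le> ereal ((1 - t) * u + t * v)"
proof -
  have "f (g t) \<le> ereal (1 - t) * f y + ereal t * f z"
    using f_convex assms unfolding convex_fun_def by blast
  also have "\<dots> \<le> ereal (1 - t) * ereal u + ereal t * ereal v"
    using assms by (intro add_mono ereal_mult_left_mono) auto
  finally show ?thesis by simp
qed

text \<open>Otherwise the sublevel sets at \<open>- n\<close> all meet the ball, and a common point
  would have value \<open>-\<infinity>\<close>.\<close>

lemma bounded_below_on_cball:
  assumes p: "p \<in> G"
  shows "\<exists>M. \<forall>z\<in>G. dist p z \<le> R \<longrightarrow> ereal M \<le> f z"
proof (rule ccontr)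
  assume "\<not> ?thesis"
  then have *: "\<exists>z\<in>G. dist p z \<le> R \<and> f z < ereal M" for M
    by (meson not_le)
  define C where "C = (\<lambda>n::nat. {z \<in> G. f z \<le> ereal (- real n)})"
  have "\<exists>y. \<forall>n. y \<in> C n"
  proof (rule nested_midconvex_Inter[OF complete geodesic uc k p])
    show "closed (C n)" for n
    proof -
      have "C n = G \<inter> {z. f z \<le> ereal (- real n)}" by (auto simp: C_def)
      then show ?thesis using f_lsc closed by (simp add: lsc_def closed_Int)
    qed
    show "decseq C"
      unfolding C_def decseq_def by (auto elim: order_trans)
    show "g (1 / 2) \<in> C n" if "y \<in> C n" "z \<in> C n" and g: "min_geodesic UNIV dist y z g" for n y z g
      using that f_geodesic_le[OF g, of "1 / 2" "- real n" "- real n"]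
        geodesically_convexD[OF G_convex _ _ g, of "1 / 2"]
      by (auto simp: C_def)
    show "\<exists>y\<in>C n. dist p y \<le> R" for n
      using *[of "- real n"] by (auto simp: C_def intro: less_imp_le)
  qed (auto simp: C_def)
  then obtain y where y: "\<And>n. f y \<le> ereal (- real n)" by (auto simp: C_def)
  have "f y = - \<infinity>"
  proof (rule ereal_bot)
    fix B
    obtain n where "- B \<le> real n" using real_arch_simple by blast
    then have "ereal (- real n) \<le> ereal B" by simp
    with y show "f y \<le> ereal B" by (rule order_trans)
  qed
  then show False using f_not_minf by blast
qed

text \<open>Boundedness of \<open>f\<close> from below on the unit ball around \<open>p\<close> forces, by convexity along rays,
  at most linear decay of \<open>f\<close>, which the quadratic term dominates.\<close>

lemma sublevel_bounded:
  assumes lam: "0 < lam" and c: "f p \<noteq> \<infinity>" "p \<in> G"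
  shows "\<exists>R. \<forall>y\<in>G. f y + ereal ((dist x y)\<^sup>2 / (2 * lam)) \<le> ereal c \<longrightarrow> dist p y \<le> R"
proof -
  obtain u where u: "f p = ereal u" using c f_not_minf[of p] by (cases "f p") auto
  obtain M where M: "\<And>z. z \<in> G \<Longrightarrow> dist p z \<le> 1 \<Longrightarrow> ereal M \<le> f z"
    using bounded_below_on_cball[OF c(2), of 1] by blast
  define e where "e = dist x p"
  define K where "K = \<bar>M\<bar> + \<bar>u\<bar>"
  \<comment> \<open>Beyond 1, the geodesic from \<open>p\<close> has a point at unit distance, so
    \<open>f y\<close> is at least \<open>- (d * K)\<close>; beyond \<open>2 * e\<close>,
    \<open>dist x y\<close> is at least \<open>d / 2\<close>. The last bound is where the square of
    \<open>d / 2\<close> exceeds \<open>2 * lam * d * (\<bar>c\<bar> + K)\<close>.\<close>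
  have "dist p y \<le> max 1 (max (2 * e) (8 * lam * (\<bar>c\<bar> + K)))"
    if y: "y \<in> G" "f y + ereal ((dist x y)\<^sup>2 / (2 * lam)) \<le> ereal c" for y
  proof (rule ccontr)
    assume "\<not> ?thesis"
    then have less: "1 < dist p y" "2 * e < dist p y" "8 * lam * (\<bar>c\<bar> + K) < dist p y" by auto
    define d where "d = dist p y"
    obtain v where v: "f y = ereal v" using y(2) f_not_minf[of y] by (cases "f y") auto
    obtain g where g: "min_geodesic UNIV dist p y g"
      using geodesic unfolding geodesic_space_def by blast
    have t: "1 / d \<in> {0..1}" using less(1) by (simp add: d_def divide_le_eq_1)
    have d0: "0 < d" using less(1) unfolding d_def by linarith
    then have d_inv: "1 / d * d = 1" by simp
    have "dist p (g (1 / d)) = 1" using min_geodesicD(1)[OF g t] d_inv by (simp add: d_def[symmetric])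
    moreover have "g (1 / d) \<in> G" using geodesically_convexD[OF G_convex c(2) y(1) g t] .
    ultimately have "ereal M \<le> f (g (1 / d))" using M by simp
    also have "\<dots> \<le> ereal ((1 - 1 / d) * u + 1 / d * v)"
      using f_geodesic_le[OF g t] u v by simp
    finally have "M \<le> (1 - 1 / d) * u + 1 / d * v" by simp
    from mult_left_mono[OF this, of d] have "d * M \<le> (d - 1) * u + v"
      using d0 by (simp add: algebra_simps)
    moreover have "- (d * \<bar>M\<bar>) \<le> d * M"
      using mult_left_mono[of "- \<bar>M\<bar>" M d] by (simp add: d_def)
    moreover have "(d - 1) * u \<le> (d - 1) * \<bar>u\<bar>"
      using less(1) by (intro mult_left_mono) (auto simp: d_def)
    moreover have "(d - 1) * \<bar>u\<bar> \<le> d * \<bar>u\<bar>" by (intro mult_right_mono) auto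
    ultimately have v_ge: "- (d * K) \<le> v" by (simp add: K_def algebra_simps)
    have "d / 2 \<le> dist x y" using less(2) unfolding d_def e_def by metric
    then have "(d / 2)\<^sup>2 \<le> (dist x y)\<^sup>2" using less by (intro power_mono) (auto simp: d_def)
    moreover have "v + (dist x y)\<^sup>2 / (2 * lam) \<le> c" using y(2) v by simp
    then have "(dist x y)\<^sup>2 \<le> 2 * lam * (c - v)" using lam by (simp add: field_simps)
    ultimately have "(d / 2)\<^sup>2 \<le> 2 * lam * (c - v)" by simp
    also have "\<dots> \<le> 2 * lam * (d * \<bar>c\<bar> + d * K)"
    proof -
      have "1 * \<bar>c\<bar> \<le> d * \<bar>c\<bar>" using less by (intro mult_right_mono) (auto simp: d_def)
      then show ?thesis using v_ge lam by (intro mult_left_mono) auto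
    qed
    finally have "d * d \<le> d * (8 * lam * (\<bar>c\<bar> + K))"
      by (simp add: power2_eq_square algebra_simps)
    then have "d \<le> 8 * lam * (\<bar>c\<bar> + K)" using d0 by (rule mult_left_le_imp_le)
    then show False using less(3) by (simp add: d_def)
  qed
  then show ?thesis by blast
qed

text \<open>The quadratic term is continuous and finite, so it moves to the right-hand side, where
  it is within \<open>e\<close> of its limit; closed sublevel sets of \<open>f\<close> then
  apply.\<close>

lemma closed_regularized_sublevel:
  assumes lam: "0 < lam"
  shows "closed {y \<in> G. f y + ereal ((dist x y)\<^sup>2 / (2 * lam)) \<le> ereal c}"
  unfolding closed_sequential_limits
proof (intro allI impI, elim conjE)
  fix y l assume y: "\<forall>n. y n \<in> {y \<in> G. f y + ereal ((dist x y)\<^sup>2 / (2 * lam)) \<le> ereal c}"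
    and l: "y \<longlonglongrightarrow> l"
  define q where "q = (\<lambda>y. (dist x y)\<^sup>2 / (2 * lam))"
  have f_le: "f (y n) \<le> ereal (c - q (y n))" for n
    using y[rule_format, of n] f_not_minf[of "y n"] by (cases "f (y n)") (auto simp: q_def)
  have "(\<lambda>n. q (y n)) \<longlonglongrightarrow> q l"
    unfolding q_def by (intro tendsto_intros l) (use lam in auto)
  have "f l \<le> ereal (c - q l) + ereal e" if "0 < e" for e :: real
  proof -
    have "\<forall>\<^sub>F n in sequentially. q l - e < q (y n)"
      using order_tendstoD(1)[OF \<open>(\<lambda>n. q (y n)) \<longlonglongrightarrow> q l\<close>] that by simp
    then have "\<forall>\<^sub>F n in sequentially. y n \<in> {z. f z \<le> ereal (c - q l + e)}"
    proof eventually_elim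
      case (elim n)
      then have "ereal (c - q (y n)) \<le> ereal (c - q l + e)" by simp
      from order_trans[OF f_le this] show ?case by simp
    qed
    moreover have "closed {z. f z \<le> ereal (c - q l + e)}" using f_lsc by (simp add: lsc_def)
    ultimately show ?thesis using Lim_in_closed_set[OF _ _ _ l] by force
  qed
  then have "f l \<le> ereal (c - q l)" using ereal_le_epsilon2 by blast
  moreover have "l \<in> G" using closed_sequentially[OF closed _ l] y by simp
  ultimately show "l \<in> {y \<in> G. f y + ereal ((dist x y)\<^sup>2 / (2 * lam)) \<le> ereal c}"
    using f_not_minf[of l] by (cases "f l") (auto simp: q_def)
qed

text \<open>The gain at the midpoint comes from the quadratic term alone. It makes sublevel sets
  midpoint convex and excludes two minimizers.\<close>

lemma regularized_midpoint_le:
  assumes lam: "0 < lam" and G: "x \<in> G" "y \<in> G" "z \<in> G"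
    and g: "min_geodesic UNIV dist y z g"
    and le: "f y + ereal ((dist x y)\<^sup>2 / (2 * lam)) \<le> ereal c"
      "f z + ereal ((dist x z)\<^sup>2 / (2 * lam)) \<le> ereal c"
  shows "f (g (1 / 2)) + ereal ((dist x (g (1 / 2)))\<^sup>2 / (2 * lam))
    \<le> ereal (c - k * (dist y z)\<^sup>2 / (2 * lam))"
proof -
  obtain u where u: "f y = ereal u" using le(1) f_not_minf[of y] by (cases "f y") auto
  obtain v where v: "f z = ereal v" using le(2) f_not_minf[of z] by (cases "f z") auto
  have "f (g (1 / 2)) \<le> ereal ((u + v) / 2)"
    using f_geodesic_le[OF g, of "1 / 2" u v] u v by (simp add: add_divide_distrib)
  moreover have "(dist x (g (1 / 2)))\<^sup>2 / (2 * lam)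
      \<le> (((dist x y)\<^sup>2 + (dist x z)\<^sup>2) / 2 - k * (dist y z)\<^sup>2) / (2 * lam)"
    using uc G g lam unfolding sqdist_uniformly_convex_def by (intro divide_right_mono) auto
  ultimately have "f (g (1 / 2)) + ereal ((dist x (g (1 / 2)))\<^sup>2 / (2 * lam))
      \<le> ereal ((u + v) / 2) + ereal ((((dist x y)\<^sup>2 + (dist x z)\<^sup>2) / 2 - k * (dist y z)\<^sup>2) / (2 * lam))"
    by (intro add_mono) auto
  also have "\<dots> = ereal (((u + (dist x y)\<^sup>2 / (2 * lam)) + (v + (dist x z)\<^sup>2 / (2 * lam))) / 2
      - k * (dist y z)\<^sup>2 / (2 * lam))"
    by (simp add: add_divide_distrib diff_divide_distrib)
  also have "\<dots> \<le> ereal (c - k * (dist y z)\<^sup>2 / (2 * lam))"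
    using le u v by simp
  finally show ?thesis .
qed

text \<open>Since \<open>resolvent\<close> is a definite description, both existence and uniqueness
  are needed. The minimizer is a common point of the sublevel sets slightly above the infimum
  \<open>A\<close>.\<close>

lemma resolvent_minimizes:
  assumes lam: "0 < lam" and x: "x \<in> G"
  shows "resolvent f G lam x \<in> G"
    and "z \<in> G \<Longrightarrow> f (resolvent f G lam x) + ereal ((dist x (resolvent f G lam x))\<^sup>2 / (2 * lam))
      \<le> f z + ereal ((dist x z)\<^sup>2 / (2 * lam))"
proof -
  define F where "F = (\<lambda>y. f y + ereal ((dist x y)\<^sup>2 / (2 * lam)))"
  obtain p where p: "p \<in> G" "f p \<noteq> \<infinity>" using f_finite by blast
  obtain u where u: "f p = ereal u" using p f_not_minf[of p] by (cases "f p") auto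
  define c where "c = u + (dist x p)\<^sup>2 / (2 * lam)"
  have Fp: "F p = ereal c" by (simp add: F_def u c_def)
  have fF: "f y \<le> F y" for y
    using lam by (auto simp: F_def intro!: ereal_le_add_self)
  \<comment> \<open>The level \<open>c + 1\<close> lies above every level
    \<open>A + 1 / Suc n\<close> used for \<open>C\<close>, so one radius serves for all of
    them.\<close>
  obtain R where R: "\<And>y. y \<in> G \<Longrightarrow> F y \<le> ereal (c + 1) \<Longrightarrow> dist p y \<le> R"
    using sublevel_bounded[OF lam p(2,1), of x "c + 1"] unfolding F_def by blast
  obtain M where M: "\<And>z. z \<in> G \<Longrightarrow> dist p z \<le> R \<Longrightarrow> ereal M \<le> f z"
    using bounded_below_on_cball[OF p(1)] by blast
  \<comment> \<open>\<open>M\<close> bounds \<open>F\<close> below on the sublevel set and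
    \<open>c\<close> does outside it; this makes the infimum finite.\<close>
  define B where "B = min M c"
  have "ereal B \<le> F y" if "y \<in> G" for y
  proof (cases "F y \<le> ereal (c + 1)")
    case True
    then have "ereal M \<le> F y" using M[OF that R[OF that]] fF[of y] by (auto intro: order_trans)
    then show ?thesis by (rule order_trans[rotated]) (simp add: B_def)
  next
    case False
    then have "ereal (c + 1) \<le> F y" by simp
    moreover have "B \<le> c + 1" by (simp add: B_def)
    then have "ereal B \<le> ereal (c + 1)" by simp
    ultimately show ?thesis by (rule order_trans[rotated])
  qed
  then have "ereal B \<le> (INF y\<in>G. F y)" by (rule INF_greatest)
  moreover have "(INF y\<in>G. F y) \<le> ereal c" using INF_lower[OF p(1), of F] Fp by simp
  ultimately obtain A where A: "(INF y\<in>G. F y) = ereal A"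
    by (cases "INF y\<in>G. F y") auto
  have A_le: "ereal A \<le> F y" if "y \<in> G" for y using INF_lower[OF that, of F] A by simp
  have Ac: "A \<le> c" using A_le[OF p(1)] Fp by simp
  define C where "C = (\<lambda>n. {y \<in> G. F y \<le> ereal (A + 1 / Suc n)})"
  have "\<exists>y. \<forall>n. y \<in> C n"
  proof (rule nested_midconvex_Inter[OF complete geodesic uc k p(1)])
    show "closed (C n)" for n
      unfolding C_def F_def using closed_regularized_sublevel[OF lam] .
    show "decseq C"
    proof (rule decseq_SucI)
      fix n
      have "ereal (A + 1 / Suc (Suc n)) \<le> ereal (A + 1 / Suc n)" by (simp add: field_simps)
      then show "C (Suc n) \<subseteq> C n" unfolding C_def by (auto elim: order_trans)
    qed
    show "g (1 / 2) \<in> C n" if yz: "y \<in> C n" "z \<in> C n" and g: "min_geodesic UNIV dist y z g" for n y z g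
    proof -
      have "F (g (1 / 2)) \<le> ereal (A + 1 / Suc n - k * (dist y z)\<^sup>2 / (2 * lam))"
        using regularized_midpoint_le[OF lam x _ _ g] yz unfolding C_def F_def by auto
      also have "\<dots> \<le> ereal (A + 1 / Suc n)" using k lam by simp
      finally show ?thesis
        using yz geodesically_convexD[OF G_convex _ _ g, of "1 / 2"] by (simp add: C_def)
    qed
    show "\<exists>y\<in>C n. dist p y \<le> R" for n
    proof -
      have "(INF y\<in>G. F y) < ereal (A + 1 / Suc n)" by (simp add: A)
      then obtain y where y: "y \<in> G" "F y < ereal (A + 1 / Suc n)" by (auto simp: INF_less_iff)
      moreover have "1 / real (Suc n) \<le> 1" by (simp only: divide_le_eq_1) simp
      then have "A + 1 / real (Suc n) \<le> c + 1" using Ac by (rule add_mono[rotated])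
      then have "ereal (A + 1 / Suc n) \<le> ereal (c + 1)" by (simp only: ereal_less_eq)
      ultimately have "F y \<le> ereal (c + 1)" by (meson less_imp_le order_trans)
      then show ?thesis using y R by (auto simp: C_def intro: less_imp_le)
    qed
  qed (auto simp: C_def)
  then obtain y where y: "\<And>n. y \<in> C n" by blast
  then have yG: "y \<in> G" by (auto simp: C_def)
  have "F y \<le> ereal A + ereal e" if "0 < e" for e
  proof -
    obtain n where "1 / Suc n < e" using nat_approx_posE[OF \<open>0 < e\<close>] .
    then have "ereal (A + 1 / Suc n) \<le> ereal A + ereal e" by simp
    with y[of n] show "F y \<le> ereal A + ereal e" by (auto simp: C_def intro: order_trans)
  qed
  then have "F y \<le> ereal A" using ereal_le_epsilon2 by blast
  define is_min where "is_min = (\<lambda>y. y \<in> G \<and> (\<forall>z\<in>G. F y \<le> F z))"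
  have min_y: "is_min y"
    using yG \<open>F y \<le> ereal A\<close> A_le by (auto simp: is_min_def intro: order_trans)
  \<comment> \<open>The midpoint of two distinct minimizers would have a value below
    \<open>A\<close>.\<close>
  have "z = y" if z: "is_min z" for z
  proof (rule ccontr)
    assume "z \<noteq> y"
    obtain g where g: "min_geodesic UNIV dist z y g"
      using geodesic unfolding geodesic_space_def by blast
    have zG: "z \<in> G" using z by (simp add: is_min_def)
    have "F z \<le> ereal A"
      using z yG \<open>F y \<le> ereal A\<close> by (auto simp: is_min_def intro: order_trans)
    then have "F (g (1 / 2)) \<le> ereal (A - k * (dist z y)\<^sup>2 / (2 * lam))"
      using regularized_midpoint_le[OF lam x zG yG g] \<open>F y \<le> ereal A\<close> by (simp add: F_def)
    moreover have "ereal A \<le> F (g (1 / 2))"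
      using A_le geodesically_convexD[OF G_convex zG yG g, of "1 / 2"] by simp
    ultimately have "ereal A \<le> ereal (A - k * (dist z y)\<^sup>2 / (2 * lam))" by (rule order_trans[rotated])
    then have "k * (dist z y)\<^sup>2 / (2 * lam) \<le> 0" by simp
    moreover have "0 < k * (dist z y)\<^sup>2 / (2 * lam)" using k lam \<open>z \<noteq> y\<close> by simp
    ultimately show False by simp
  qed
  then have "(THE y. is_min y) = y" using min_y by (rule the_equality[rotated])
  then have "resolvent f G lam x = y" by (simp add: resolvent_def is_min_def F_def)
  then show "resolvent f G lam x \<in> G"
    and "z \<in> G \<Longrightarrow> f (resolvent f G lam x) + ereal ((dist x (resolvent f G lam x))\<^sup>2 / (2 * lam))
      \<le> f z + ereal ((dist x z)\<^sup>2 / (2 * lam))"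
    using min_y by (auto simp: is_min_def F_def)
qed

section \<open>Effect of one resolvent step\<close>

lemma resolvent_finite:
  assumes lam: "0 < lam" and x: "x \<in> G"
  shows "f (resolvent f G lam x) \<noteq> \<infinity>"
proof -
  obtain p where p: "p \<in> G" "f p \<noteq> \<infinity>" using f_finite by blast
  then show ?thesis using resolvent_minimizes(2)[OF lam x p(1)] by (cases "f p") auto
qed

lemma resolvent_le:
  assumes lam: "0 < lam" and x: "x \<in> G"
  shows "f (resolvent f G lam x) \<le> f x"
proof -
  have "f (resolvent f G lam x) \<le> f (resolvent f G lam x)
      + ereal ((dist x (resolvent f G lam x))\<^sup>2 / (2 * lam))"
    using lam by (intro ereal_le_add_self) simp
  also have "\<dots> \<le> f x" using resolvent_minimizes(2)[OF lam x x] by simp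
  finally show ?thesis .
qed

text \<open>Minimality of the resolvent against \<open>g t\<close>, with \<open>f\<close> bounded by
  its chord, gives the linear growth required by \<open>sqdist_first_variation\<close>;
  \<open>vu\<close> makes its rate nonnegative.\<close>

lemma resolvent_decrease:
  assumes alex: "alexandrov_le \<kappa> TYPE('a)"
    and diam: "\<kappa> > 0 \<longrightarrow> bounded G \<and> diameter G < pi / (2 * sqrt \<kappa>)"
    and lam: "0 < lam" and x: "x \<in> G" and y: "y \<in> G"
    and u: "f (resolvent f G lam x) = ereal u" and v: "f y = ereal v" and vu: "v \<le> u"
  shows "2 * lam * (u - v) \<le> (dist x y)\<^sup>2 - (dist (resolvent f G lam x) y)\<^sup>2"
proof -
  define p where "p = resolvent f G lam x"
  have p: "p \<in> G" using resolvent_minimizes(1)[OF lam x] by (simp add: p_def)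
  obtain g where g: "min_geodesic UNIV dist p y g"
    using geodesic unfolding geodesic_space_def by blast
  have "t * (2 * lam * (u - v)) \<le> (dist x (g t))\<^sup>2 - (dist x p)\<^sup>2" if t: "t \<in> {0..1}" for t
  proof -
    have "ereal (u + (dist x p)\<^sup>2 / (2 * lam)) \<le> f (g t) + ereal ((dist x (g t))\<^sup>2 / (2 * lam))"
      using resolvent_minimizes(2)[OF lam x geodesically_convexD[OF G_convex p y g t]] u
      by (simp add: p_def)
    also have "\<dots> \<le> ereal ((1 - t) * u + t * v) + ereal ((dist x (g t))\<^sup>2 / (2 * lam))"
      using f_geodesic_le[OF g t] u v by (intro add_right_mono) (simp add: p_def)
    finally have "u + (dist x p)\<^sup>2 / (2 * lam) \<le> (1 - t) * u + t * v + (dist x (g t))\<^sup>2 / (2 * lam)"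
      by simp
    then have "t * (u - v) \<le> ((dist x (g t))\<^sup>2 - (dist x p)\<^sup>2) / (2 * lam)"
      by (simp add: algebra_simps diff_divide_distrib)
    then show ?thesis using lam by (simp add: field_simps)
  qed
  then show ?thesis
    using sqdist_first_variation[OF alex G_convex diam p x y g, of "2 * lam * (u - v)"] lam vu
    by (simp add: p_def)
qed

end

section \<open>Convergence of the values along the iteration\<close>

theorem theorem5p1:
  fixes \<kappa> :: real and f :: "'a::metric_space \<Rightarrow> ereal" and G :: "'a set"
    and lam :: "nat \<Rightarrow> real" and x :: "nat \<Rightarrow> 'a" and x0 :: 'a
  assumes complete: "complete (UNIV :: 'a set)"
    and alex: "alexandrov_le \<kappa> TYPE('a)"
    and f_not_minf: "\<forall>y. f y \<noteq> -\<infinity>"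
    and f_proper: "\<exists>y. f y \<noteq> \<infinity>"
    and f_convex: "convex_fun f"
    and f_lsc: "lsc f"
    and G_closed: "closed G"
    and G_convex: "geodesically_convex G"
    and G_sublevel: "\<exists>c::real. {y. f y \<le> ereal c} \<noteq> {} \<and> {y. f y \<le> ereal c} \<subseteq> G"
    and G_diam: "\<kappa> > 0 \<longrightarrow> bounded G \<and> diameter G < pi / (2 * sqrt \<kappa>)"
    and lam_pos: "\<forall>k\<ge>1. lam k > 0"
    and lam_sum: "filterlim (\<lambda>n. \<Sum>k=1..n. lam k) at_top sequentially"
    and x0_G: "x0 \<in> G"
    and x_0: "x 0 = x0"
    and x_step: "\<forall>k\<ge>1. x k = resolvent f G (lam k) (x (k - 1))"
  shows "(\<lambda>k. f (x k)) \<longlonglongrightarrow> (INF y\<in>G. f y)"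
proof -
  obtain k where k: "0 < k" "sqdist_uniformly_convex G k"
    using sqdist_uniformly_convex_alexandrov[OF alex G_convex G_diam] by blast
  interpret convex_minimization f G k
  proof
    show "geodesic_space TYPE('a)" using alex by (simp add: alexandrov_le_def)
    show "\<exists>y\<in>G. f y \<noteq> \<infinity>" using G_sublevel by force
  qed (use k assms in auto)
  have step: "x (Suc n) = resolvent f G (lam (Suc n)) (x n)" and pos: "0 < lam (Suc n)" for n
    using x_step lam_pos by auto
  have xG: "x n \<in> G" for n
  proof (induction n)
    case (Suc n)
    then show ?case using resolvent_minimizes(1)[OF pos] step by simp
  qed (simp add: x_0 x0_G)
  have dec: "decseq (\<lambda>n. f (x n))"
    using resolvent_le[OF pos xG] step by (intro decseq_SucI) simp
  have "(INF n. f (x n)) \<le> f y" if y: "y \<in> G" for y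
  proof (rule ccontr)
    assume "\<not> ?thesis"
    then have less: "f y < (INF n. f (x n))" by simp
    then obtain v where v: "f y = ereal v" using f_not_minf[of y] by (cases "f y") auto
    \<comment> \<open>A level strictly between makes the gain per step at least a fixed multiple of
      \<open>lam (Suc n)\<close>.\<close>
    obtain w where w: "v < w" "ereal w < (INF n. f (x n))"
      using ereal_dense2[OF less] v by auto
    have drop: "2 * lam (Suc n) * (w - v) \<le> (dist (x n) y)\<^sup>2 - (dist (x (Suc n)) y)\<^sup>2" for n
    proof -
      have "f (x (Suc n)) \<noteq> \<infinity>" using resolvent_finite[OF pos xG] step by simp
      then obtain u where u: "f (x (Suc n)) = ereal u"
        using f_not_minf[of "x (Suc n)"] by (cases "f (x (Suc n))") auto
      have "ereal w < f (x (Suc n))" using w(2) by (rule less_INF_D) simp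
      then have wu: "w < u" using u by simp
      then have "2 * lam (Suc n) * (w - v) \<le> 2 * lam (Suc n) * (u - v)"
        using pos[of n] by (intro mult_left_mono) auto
      also have "\<dots> \<le> (dist (x n) y)\<^sup>2 - (dist (x (Suc n)) y)\<^sup>2"
        using resolvent_decrease[OF alex G_diam pos xG y, of n n u v] u v w wu step by simp
      finally show ?thesis .
    qed
    \<comment> \<open>Telescoping \<open>drop\<close> bounds all partial sums by a constant, against
      their divergence.\<close>
    have "2 * (w - v) * (\<Sum>k=1..n. lam k) \<le> (dist (x 0) y)\<^sup>2 - (dist (x n) y)\<^sup>2" for n
    proof (induction n)
      case (Suc n)
      then show ?case using drop[of n] by (simp add: algebra_simps)
    qed simp
    then have bound: "(\<Sum>k=1..n. lam k) \<le> (dist (x 0) y)\<^sup>2 / (2 * (w - v))" for n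
      using w(1) zero_le_power2[of "dist (x n) y"]
      by (smt (verit) pos_le_divide_eq mult.commute)
    have "\<forall>\<^sub>F n in sequentially. (dist (x 0) y)\<^sup>2 / (2 * (w - v)) < (\<Sum>k=1..n. lam k)"
      using lam_sum by (simp add: filterlim_at_top_dense)
    then show False
      using bound by (auto simp: eventually_sequentially not_less[symmetric])
  qed
  then have "(INF n. f (x n)) \<le> (INF y\<in>G. f y)" by (rule INF_greatest)
  moreover have "(INF y\<in>G. f y) \<le> (INF n. f (x n))" by (intro INF_greatest INF_lower xG)
  ultimately have "(INF n. f (x n)) = (INF y\<in>G. f y)" by simp
  then show ?thesis using LIMSEQ_INF[OF dec] by simp
qed

end
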